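(* Let $K$ be a finite, connected, abstract simplicial complex, let $\mathcal{M}(K)$ be its Morse complex, and let $\mathcal{H}(K)$ be its Hasse diagram, viewed as a graph. Then $\mathrm{Aut}(\mathcal{M}(K))\cong\mathrm{Aut}(\mathcal{H}(K))$ as groups.
   Context: Simplices are nonempty finite sets of vertices. For simplices, $\sigma^{(p)}$ means that $\sigma$ has dimension $p$, and $\tau<\sigma$ means that $\tau$ is a face of $\sigma$ of strictly smaller dimension. A simplicial automorphism of a complex is a bijection of the complex to itself induced by a map of the vertex set that sends simplices to simplices; $\mathrm{Aut}$ of a complex is the group of these under composition (trivial if the complex has no vertices). The Hasse diagram $\mathcal{H}(K)$ is that of the set of simplices of $K$ partially ordered by the face relation, viewed as an undirected graph: its nodes are the simplices of $K$, and two nodes $\sigma,\tau$ are joined by an edge exactly when one is a codimension $1$ face of the other. $\mathrm{Aut}(\mathcal{H}(K))$ is the group of graph automorphisms (equivalently, simplicial automorphisms of the graph as a 1-dimensional complex); they are not required to preserve the order. Morse complex. A discrete vector field $V$ on $K$ is a set of pairs $(\sigma^{(p)},\tau^{(p+1)})$ of simplices of $K$ with $\sigma<\tau$ such that each simplex of $K$ is in at most one pair; the pairs are called regular pairs. A $V$-path is a sequence $\alpha_0^{(p)},\beta_0^{(p+1)},\alpha_1^{(p)},\dots,\beta_{k-1}^{(p+1)},\alpha_k^{(p)}$ of simplices of $K$ with $(\alpha_i,\beta_i)\in V$ and $\beta_i>\alpha_{i+1}\ne\alpha_i$ for $0\le i\le k-1$; it is non-trivial if $k\neq 0$ and closed if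 $\alpha_k=\alpha_0$. A gradient vector field is a discrete vector field with no non-trivial closed $V$-path. It is primitive if it has exactly one regular pair. The Morse complex $\mathcal{M}(K)$ is the simplicial complex whose vertices are the primitive gradient vector fields on $K$ (i.e. the pairs $(\sigma^{(p)},\tau^{(p+1)})$ with $\sigma<\tau$) and whose $n$-simplices are the gradient vector fields with $n+1$ regular pairs, such a gradient vector field being identified with the set of primitive gradient vector fields given by its regular pairs. *)

theory Defs
  imports "HOL-Algebra.Bij"
begin

text \<open>
  A complex is its set of (nonempty, finite) simplices; its vertex set is the union of the
  simplices. The complex without simplices is allowed.
\<close>

definition abstract_complex :: "'a set set \<Rightarrow> bool" where
  "abstract_complex K \<longleftrightarrow>
     (\<forall>\<sigma>\<in>K. finite \<sigma> \<and> \<sigma> \<noteq> {}) \<and> (\<forall>\<sigma>\<in>K. \<forall>\<tau>. \<tau> \<subseteq> \<sigma> \<and> \<tau> \<noteq> {} \<longrightarrow> \<tau> \<in> K)"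

definition sdim :: "'a set \<Rightarrow> nat" where
  "sdim \<sigma> = card \<sigma> - 1"

definition connected_complex :: "'a set set \<Rightarrow> bool" where
  "connected_complex K \<longleftrightarrow> (\<forall>u\<in>\<Union>K. \<forall>v\<in>\<Union>K. (u, v) \<in> {(x, y). {x, y} \<in> K}\<^sup>*)"

text \<open>
  Simplicial automorphisms are bijections of the set of simplices. As in the library's
  \<^const>\<open>Bij\<close>, they are taken to be extensional (\<^const>\<open>undefined\<close> outside the complex),
  so that a bijection has exactly one representing function.
\<close>

definition simplicial_auts :: "'a set set \<Rightarrow> ('a set \<Rightarrow> 'a set) set" where
  "simplicial_auts L =
     {\<phi> \<in> Bij L. \<exists>f \<in> \<Union>L \<rightarrow> \<Union>L. (\<forall>\<sigma>\<in>L. f ` \<sigma> \<in> L) \<and> (\<forall>\<sigma>\<in>L. \<phi> \<sigma> = f ` \<sigma>)}"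

definition simplicial_aut_group :: "'a set set \<Rightarrow> ('a set \<Rightarrow> 'a set) monoid" where
  "simplicial_aut_group L = (BijGroup L)\<lparr>carrier := simplicial_auts L\<rparr>"

text \<open>
  A graph is given by a node set and a set of two-element sets of nodes. The node set of the
  Hasse diagram of \<open>K\<close> is \<open>K\<close> itself.
\<close>

definition graph_auts :: "'v set \<Rightarrow> 'v set set \<Rightarrow> ('v \<Rightarrow> 'v) set" where
  "graph_auts N E = {f \<in> Bij N. \<forall>x\<in>N. \<forall>y\<in>N. {f x, f y} \<in> E \<longleftrightarrow> {x, y} \<in> E}"

definition graph_aut_group :: "'v set \<Rightarrow> 'v set set \<Rightarrow> ('v \<Rightarrow> 'v) monoid" where
  "graph_aut_group N E = (BijGroup N)\<lparr>carrier := graph_auts N E\<rparr>"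

definition hasse_edges :: "'a set set \<Rightarrow> 'a set set set" where
  "hasse_edges K = {{\<sigma>, \<tau>} | \<sigma> \<tau>. \<sigma> \<in> K \<and> \<tau> \<in> K \<and> \<sigma> \<subset> \<tau> \<and> sdim \<tau> = sdim \<sigma> + 1}"

definition discrete_vector_field :: "'a set set \<Rightarrow> ('a set \<times> 'a set) set \<Rightarrow> bool" where
  "discrete_vector_field K V \<longleftrightarrow>
     (\<forall>(\<sigma>, \<tau>)\<in>V. \<sigma> \<in> K \<and> \<tau> \<in> K \<and> \<sigma> \<subset> \<tau> \<and> sdim \<tau> = sdim \<sigma> + 1) \<and>
     (\<forall>\<rho>\<in>K. \<forall>P\<in>V. \<forall>Q\<in>V. \<rho> \<in> {fst P, snd P} \<and> \<rho> \<in> {fst Q, snd Q} \<longrightarrow> P = Q)"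

text \<open>
  The path is \<open>\<alpha> 0, \<beta> 0, \<alpha> 1, \<dots>, \<beta> (k - 1), \<alpha> k\<close>; values of \<open>\<alpha>\<close> and \<open>\<beta>\<close> at other
  indices are irrelevant.
\<close>

definition V_path ::
  "'a set set \<Rightarrow> ('a set \<times> 'a set) set \<Rightarrow> (nat \<Rightarrow> 'a set) \<Rightarrow> (nat \<Rightarrow> 'a set) \<Rightarrow> nat \<Rightarrow> bool" where
  "V_path K V \<alpha> \<beta> k \<longleftrightarrow>
     (\<exists>p. (\<forall>i\<le>k. \<alpha> i \<in> K \<and> sdim (\<alpha> i) = p) \<and> (\<forall>i<k. \<beta> i \<in> K \<and> sdim (\<beta> i) = p + 1)) \<and>
     (\<forall>i<k. (\<alpha> i, \<beta> i) \<in> V \<and> \<alpha> (i + 1) \<subset> \<beta> i \<and> \<alpha> (i + 1) \<noteq> \<alpha> i)"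

definition gradient_vector_field :: "'a set set \<Rightarrow> ('a set \<times> 'a set) set \<Rightarrow> bool" where
  "gradient_vector_field K V \<longleftrightarrow>
     discrete_vector_field K V \<and> \<not> (\<exists>\<alpha> \<beta> k. V_path K V \<alpha> \<beta> k \<and> k \<noteq> 0 \<and> \<alpha> k = \<alpha> 0)"

text \<open>
  A primitive gradient vector field is identified with its only regular pair, so the vertices
  are pairs and a gradient vector field, being a set of pairs, is itself a simplex.
\<close>

definition morse_complex :: "'a set set \<Rightarrow> ('a set \<times> 'a set) set set" where
  "morse_complex K = {V. gradient_vector_field K V \<and> finite V \<and> V \<noteq> {}}"

lemma abstract_complex_morse_complex: "abstract_complex (morse_complex K)"
proof -
  have "gradient_vector_field K W" if "gradient_vector_field K V" "W \<subseteq> V" for V W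
  proof -
    have "discrete_vector_field K W"
      using that unfolding gradient_vector_field_def discrete_vector_field_def
      by (meson subsetD)
    moreover have "V_path K V \<alpha> \<beta> k" if "V_path K W \<alpha> \<beta> k" for \<alpha> \<beta> k
      using that \<open>W \<subseteq> V\<close> unfolding V_path_def by (meson subsetD)
    ultimately show ?thesis
      using that(1) unfolding gradient_vector_field_def by meson
  qed
  then show ?thesis
    unfolding abstract_complex_def morse_complex_def by (simp, meson finite_subset)
qed

lemma Union_morse_complex:
  "\<Union>(morse_complex K) = {(\<sigma>, \<tau>). \<sigma> \<in> K \<and> \<tau> \<in> K \<and> \<sigma> \<subset> \<tau> \<and> sdim \<tau> = sdim \<sigma> + 1}"
    (is "_ = ?E")
proof
  show "\<Union>(morse_complex K) \<subseteq> ?E"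
    unfolding morse_complex_def gradient_vector_field_def discrete_vector_field_def by auto
  show "?E \<subseteq> \<Union>(morse_complex K)"
  proof
    fix e assume "e \<in> ?E"
    have "\<not> (V_path K {e} \<alpha> \<beta> k \<and> k \<noteq> 0 \<and> \<alpha> k = \<alpha> 0)" for \<alpha> \<beta> k
    proof
      assume *: "V_path K {e} \<alpha> \<beta> k \<and> k \<noteq> 0 \<and> \<alpha> k = \<alpha> 0"
      have fst: "\<alpha> i = fst e" and ne: "\<alpha> (i + 1) \<noteq> \<alpha> i" if "i < k" for i
        using * that unfolding V_path_def by force+
      have "\<alpha> 1 = fst e"
      proof (cases "k = 1")
        case True
        then show ?thesis using * fst[of 0] by simp
      next
        case False
        then show ?thesis using * fst[of 1] by simp
      qed
      then show False using * fst[of 0] ne[of 0] by simp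
    qed
    moreover have "discrete_vector_field K {e}"
      using \<open>e \<in> ?E\<close> unfolding discrete_vector_field_def by auto
    ultimately have "{e} \<in> morse_complex K"
      unfolding morse_complex_def gradient_vector_field_def by blast
    then show "e \<in> \<Union>(morse_complex K)" by blast
  qed
qed

lemma subgroup_graph_auts: "subgroup (graph_auts N E) (BijGroup N)"
proof (rule group.subgroupI[OF group_BijGroup])
  show "graph_auts N E \<subseteq> carrier (BijGroup N)"
    by (auto simp: graph_auts_def BijGroup_def)
  have "(\<lambda>x\<in>N. x) \<in> graph_auts N E"
    by (auto simp: graph_auts_def id_Bij)
  then show "graph_auts N E \<noteq> {}" by blast
next
  fix f assume f: "f \<in> graph_auts N E"
  then have fB: "f \<in> Bij N" by (simp add: graph_auts_def)
  then have bij: "bij_betw f N N" by (simp add: Bij_def)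
  have inv: "inv\<^bsub>BijGroup N\<^esub> f = (\<lambda>x\<in>N. inv_into N f x)"
    using fB by (simp add: inv_BijGroup)
  have "{inv_into N f x, inv_into N f y} \<in> E \<longleftrightarrow> {x, y} \<in> E" if "x \<in> N" "y \<in> N" for x y
  proof -
    have "inv_into N f x \<in> N" "inv_into N f y \<in> N"
      "f (inv_into N f x) = x" "f (inv_into N f y) = y"
      using bij that by (auto simp: bij_betw_def f_inv_into_f inv_into_into)
    then show ?thesis using f unfolding graph_auts_def by fastforce
  qed
  then show "inv\<^bsub>BijGroup N\<^esub> f \<in> graph_auts N E"
    using fB by (simp add: inv graph_auts_def restrict_inv_into_Bij)
next
  fix f g assume fg: "f \<in> graph_auts N E" "g \<in> graph_auts N E"
  then have B: "f \<in> Bij N" "g \<in> Bij N" by (auto simp: graph_auts_def)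
  have "\<And>x. x \<in> N \<Longrightarrow> g x \<in> N" using B(2) Bij_imp_funcset by blast
  then show "f \<otimes>\<^bsub>BijGroup N\<^esub> g \<in> graph_auts N E"
    using fg B by (auto simp: BijGroup_def graph_auts_def compose_Bij compose_eq)
qed

lemma subgroup_simplicial_auts:
  assumes "abstract_complex L"
  shows "subgroup (simplicial_auts L) (BijGroup L)"
proof (rule group.subgroupI[OF group_BijGroup])
  show "simplicial_auts L \<subseteq> carrier (BijGroup L)"
    by (auto simp: simplicial_auts_def BijGroup_def)
  have "(\<lambda>x\<in>L. x) \<in> simplicial_auts L"
    unfolding simplicial_auts_def using id_Bij by (auto intro!: bexI[of _ "\<lambda>x. x"])
  then show "simplicial_auts L \<noteq> {}" by blast
next
  fix \<phi> assume "\<phi> \<in> simplicial_auts L"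
  then obtain f where \<phi>: "\<phi> \<in> Bij L" and f: "f \<in> \<Union>L \<rightarrow> \<Union>L" "\<forall>\<sigma>\<in>L. \<phi> \<sigma> = f ` \<sigma>"
    by (auto simp: simplicial_auts_def)
  have bij: "bij_betw \<phi> L L" using \<phi> by (simp add: Bij_def)
  have sing: "{v} \<in> L" if "v \<in> \<Union>L" for v
  proof -
    from that obtain \<sigma> where "\<sigma> \<in> L" "v \<in> \<sigma>" by blast
    then have "{v} \<subseteq> \<sigma>" "{v} \<noteq> {}" by auto
    with assms \<open>\<sigma> \<in> L\<close> show ?thesis unfolding abstract_complex_def by meson
  qed
  have inj: "inj_on f (\<Union>L)"
  proof (rule inj_onI)
    fix x y assume "x \<in> \<Union>L" "y \<in> \<Union>L" "f x = f y"
    then have "\<phi> {x} = \<phi> {y}" using f sing by auto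
    then show "x = y"
      using bij sing \<open>x \<in> \<Union>L\<close> \<open>y \<in> \<Union>L\<close> by (metis bij_betw_def inj_onD singleton_inject)
  qed
  define g where "g = inv_into (\<Union>L) f"
  have inv_eq: "inv_into L \<phi> \<tau> = g ` \<tau>" and inv_in: "inv_into L \<phi> \<tau> \<in> L" if "\<tau> \<in> L" for \<tau>
  proof -
    have *: "inv_into L \<phi> \<tau> \<in> L" "\<phi> (inv_into L \<phi> \<tau>) = \<tau>"
      using bij that by (auto simp: bij_betw_def f_inv_into_f inv_into_into)
    then have "\<tau> = f ` inv_into L \<phi> \<tau>" using f by metis
    moreover have "g ` f ` inv_into L \<phi> \<tau> = inv_into L \<phi> \<tau>"
      unfolding g_def using inj * by (intro inv_into_image_cancel) auto
    ultimately show "inv_into L \<phi> \<tau> = g ` \<tau>" by metis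
    show "inv_into L \<phi> \<tau> \<in> L" by fact
  qed
  have "g \<in> \<Union>L \<rightarrow> \<Union>L"
  proof
    fix v assume "v \<in> \<Union>L"
    then have "g ` {v} \<in> L" using inv_eq inv_in sing by metis
    then show "g v \<in> \<Union>L" by blast
  qed
  then have "(\<lambda>\<tau>\<in>L. inv_into L \<phi> \<tau>) \<in> simplicial_auts L"
    unfolding simplicial_auts_def using \<phi> inv_eq inv_in
    by (auto simp: restrict_inv_into_Bij intro!: bexI[of _ g])
  then show "inv\<^bsub>BijGroup L\<^esub> \<phi> \<in> simplicial_auts L"
    using \<phi> by (simp add: inv_BijGroup)
next
  fix \<phi> \<psi> assume *: "\<phi> \<in> simplicial_auts L" "\<psi> \<in> simplicial_auts L"
  then have B: "\<phi> \<in> Bij L" "\<psi> \<in> Bij L" by (auto simp: simplicial_auts_def)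
  obtain f where f: "f \<in> \<Union>L \<rightarrow> \<Union>L" "\<forall>\<sigma>\<in>L. f ` \<sigma> \<in> L" "\<forall>\<sigma>\<in>L. \<phi> \<sigma> = f ` \<sigma>"
    using *(1) unfolding simplicial_auts_def mem_Collect_eq by (elim conjE bexE)
  obtain g where g: "g \<in> \<Union>L \<rightarrow> \<Union>L" "\<forall>\<sigma>\<in>L. g ` \<sigma> \<in> L" "\<forall>\<sigma>\<in>L. \<psi> \<sigma> = g ` \<sigma>"
    using *(2) unfolding simplicial_auts_def mem_Collect_eq by (elim conjE bexE)
  have "f \<circ> g \<in> \<Union>L \<rightarrow> \<Union>L" using f(1) g(1) by (intro funcsetI) (simp only: comp_apply funcset_mem)
  moreover have "\<forall>\<sigma>\<in>L. (f \<circ> g) ` \<sigma> \<in> L" using f(2) g(2) unfolding image_comp[symmetric] by blast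
  moreover have "\<forall>\<sigma>\<in>L. compose L \<phi> \<psi> \<sigma> = (f \<circ> g) ` \<sigma>"
    using f(3) g(2,3) unfolding image_comp[symmetric] by (simp add: compose_eq)
  ultimately have "compose L \<phi> \<psi> \<in> simplicial_auts L"
    unfolding simplicial_auts_def mem_Collect_eq using compose_Bij[OF B] by (intro conjI bexI)
  then show "\<phi> \<otimes>\<^bsub>BijGroup L\<^esub> \<psi> \<in> simplicial_auts L"
    using B by (simp add: BijGroup_def)
qed

lemma group_graph_aut_group: "group (graph_aut_group N E)"
  unfolding graph_aut_group_def
  by (rule subgroup.subgroup_is_group[OF subgroup_graph_auts group_BijGroup])

lemma group_simplicial_aut_group: "abstract_complex L \<Longrightarrow> group (simplicial_aut_group L)"
  unfolding simplicial_aut_group_def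
  by (rule subgroup.subgroup_is_group[OF subgroup_simplicial_auts group_BijGroup])

end

theory Submission
  imports Defs
begin

text \<open>
  Two primitive vector fields are compatible iff the corresponding edges of \<open>\<H>(K)\<close> are disjoint,
  so a simplicial automorphism of \<open>\<M>(K)\<close> permutes the edges of \<open>\<H>(K)\<close> preserving adjacency.
  As \<open>\<H>(K)\<close> is connected and bipartite and is not a single edge, such a permutation comes from a
  unique graph automorphism (Whitney).

  Conversely, a graph automorphism of \<open>\<H>(K)\<close> has to map acyclic matchings to acyclic matchings.
  It does so because it preserves or reverses the face order: view \<open>\<H>(K)\<close> inside the graph of a
  hypercube. An edge pointing up in the order is mapped to one pointing up or down, and
  opposite edges of a 4-cycle behave alike. Transporting along 4-cycles reduces the comparison of
  two edges at a node to the edges inside a triangle of \<open>K\<close>, and these behave alike because the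
  faces of a triangle form a 3-cube with exactly one vertex, the empty set, missing.
\<close>

section \<open>Toggling one vertex: the edges of the hypercube graph on sets\<close>

definition flip :: "'a \<Rightarrow> 'a set \<Rightarrow> 'a set" where
  "flip x \<sigma> = (if x \<in> \<sigma> then \<sigma> - {x} else insert x \<sigma>)"

lemma mem_flip [simp]: "y \<in> flip x \<sigma> \<longleftrightarrow> (y \<in> \<sigma>) \<noteq> (y = x)"
  by (auto simp: flip_def)

lemma flip_flip [simp]: "flip x (flip x \<sigma>) = \<sigma>"
  by auto

lemma flip_commute: "flip x (flip y \<sigma>) = flip y (flip x \<sigma>)"
  by (auto simp: set_eq_iff)

lemma flip_eq_iff [simp]: "flip x \<sigma> = flip y \<sigma> \<longleftrightarrow> x = y"
  by (metis mem_flip)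

text \<open>Both sides differ from \<open>\<sigma>\<close> in the same vertices. As \<open>z\<close>
  and \<open>x\<close> are distinct, these are exactly \<open>x\<close> and \<open>z\<close>, so the
  other route toggles the same two vertices, and in the opposite order since
  \<open>x \<noteq> y\<close>.\<close>

lemma flip_flip_eqD:
  assumes "flip z (flip x \<sigma>) = flip w (flip y \<sigma>)" "x \<noteq> y" "z \<noteq> x"
  shows "z = y \<and> w = x"
proof -
  have *: "(v = z) = (v = x) \<longleftrightarrow> (v = w) = (v = y)" for v
    using assms(1) unfolding set_eq_iff mem_flip by blast
  show ?thesis using *[of x] *[of y] assms(2,3) by metis
qed

section \<open>Facets, 4-cycles and connectedness in the Hasse diagram\<close>

locale connected_simplicial_complex =
  fixes K :: "'a set set"
  assumes complex: "abstract_complex K"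
    and connected: "connected_complex K"
begin

definition facet :: "'a set \<Rightarrow> 'a set \<Rightarrow> bool" where
  "facet \<sigma> \<tau> \<longleftrightarrow> \<sigma> \<in> K \<and> \<tau> \<in> K \<and> \<sigma> \<subset> \<tau> \<and> sdim \<tau> = sdim \<sigma> + 1"

definition adj :: "'a set \<Rightarrow> 'a set \<Rightarrow> bool" where
  "adj \<sigma> \<tau> \<longleftrightarrow> facet \<sigma> \<tau> \<or> facet \<tau> \<sigma>"

lemma finite_simplex: "\<sigma> \<in> K \<Longrightarrow> finite \<sigma>"
  and simplex_nonempty: "\<sigma> \<in> K \<Longrightarrow> \<sigma> \<noteq> {}"
  and face_in: "\<sigma> \<in> K \<Longrightarrow> \<tau> \<subseteq> \<sigma> \<Longrightarrow> \<tau> \<noteq> {} \<Longrightarrow> \<tau> \<in> K"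
  using complex unfolding abstract_complex_def by blast+

text \<open>\<open>sdim\<close> is a truncated subtraction. It loses nothing on simplices, which are
  finite and nonempty, so dimensions can be traded for cardinalities.\<close>

lemma card_facet: "facet \<sigma> \<tau> \<Longrightarrow> card \<tau> = Suc (card \<sigma>)"
  unfolding facet_def sdim_def
  by (metis One_nat_def Suc_eq_plus1 Suc_pred card_gt_0_iff finite_simplex simplex_nonempty)

lemma facet_iff: "facet \<sigma> \<tau> \<longleftrightarrow> \<sigma> \<in> K \<and> \<tau> \<in> K \<and> (\<exists>x. x \<notin> \<sigma> \<and> \<tau> = insert x \<sigma>)"
proof
  assume f: "facet \<sigma> \<tau>"
  then obtain x where x: "x \<in> \<tau>" "x \<notin> \<sigma>" unfolding facet_def by blast
  have fin: "finite \<tau>" "finite \<sigma>" using f finite_simplex unfolding facet_def by auto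
  have "insert x \<sigma> = \<tau>"
    using f x fin card_facet[OF f] by (intro card_seteq) (auto simp: facet_def)
  then show "\<sigma> \<in> K \<and> \<tau> \<in> K \<and> (\<exists>x. x \<notin> \<sigma> \<and> \<tau> = insert x \<sigma>)"
    using x f unfolding facet_def by blast
next
  assume *: "\<sigma> \<in> K \<and> \<tau> \<in> K \<and> (\<exists>x. x \<notin> \<sigma> \<and> \<tau> = insert x \<sigma>)"
  then have "card \<tau> = Suc (card \<sigma>)" "card \<sigma> > 0"
    using finite_simplex simplex_nonempty by (auto simp: card_gt_0_iff)
  then show "facet \<sigma> \<tau>" using * unfolding facet_def sdim_def by auto
qed

lemma facet_card_iff: "facet \<sigma> \<tau> \<longleftrightarrow> \<sigma> \<in> K \<and> \<tau> \<in> K \<and> \<sigma> \<subseteq> \<tau> \<and> card \<tau> = Suc (card \<sigma>)"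
proof
  show "facet \<sigma> \<tau>" if "\<sigma> \<in> K \<and> \<tau> \<in> K \<and> \<sigma> \<subseteq> \<tau> \<and> card \<tau> = Suc (card \<sigma>)"
  proof -
    have "card \<sigma> > 0" using that finite_simplex simplex_nonempty by (auto simp: card_gt_0_iff)
    then show ?thesis using that unfolding facet_def sdim_def by auto
  qed
qed (use card_facet in \<open>auto simp: facet_def\<close>)

lemma facet_flip: "facet \<sigma> (flip x \<sigma>) \<longleftrightarrow> \<sigma> \<in> K \<and> flip x \<sigma> \<in> K \<and> x \<notin> \<sigma>"
proof (cases "x \<in> \<sigma>")
  case True
  then have "flip x \<sigma> \<subseteq> \<sigma>" by (auto simp: flip_def)
  then show ?thesis using True unfolding facet_def by auto
next
  case False
  then show ?thesis unfolding facet_iff by (auto simp: flip_def)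
qed

lemma facet_asym: "facet \<sigma> \<tau> \<Longrightarrow> \<not> facet \<tau> \<sigma>"
  unfolding facet_def by auto

lemma adj_iff: "adj \<sigma> \<tau> \<longleftrightarrow> \<sigma> \<in> K \<and> \<tau> \<in> K \<and> (\<exists>x. \<tau> = flip x \<sigma>)"
proof
  assume "adj \<sigma> \<tau>"
  then consider "facet \<sigma> \<tau>" | "facet \<tau> \<sigma>" unfolding adj_def by blast
  then show "\<sigma> \<in> K \<and> \<tau> \<in> K \<and> (\<exists>x. \<tau> = flip x \<sigma>)"
  proof cases
    case 1
    then show ?thesis unfolding facet_iff by (auto simp: flip_def)
  next
    case 2
    then obtain x where "\<tau> \<in> K" "\<sigma> \<in> K" "x \<notin> \<tau>" "\<sigma> = insert x \<tau>" unfolding facet_iff by blast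
    then show ?thesis by (auto simp: flip_def intro!: exI[of _ x])
  qed
next
  assume "\<sigma> \<in> K \<and> \<tau> \<in> K \<and> (\<exists>x. \<tau> = flip x \<sigma>)"
  then show "adj \<sigma> \<tau>"
    unfolding adj_def by (metis facet_flip flip_flip mem_flip)
qed

lemma adj_sym: "adj \<sigma> \<tau> \<Longrightarrow> adj \<tau> \<sigma>"
  unfolding adj_def by blast

lemma adj_in: "adj \<sigma> \<tau> \<Longrightarrow> \<sigma> \<in> K \<and> \<tau> \<in> K"
  unfolding adj_iff by blast

lemma hasse_edges_iff: "{\<sigma>, \<tau>} \<in> hasse_edges K \<longleftrightarrow> adj \<sigma> \<tau>"
  unfolding hasse_edges_def adj_def facet_def by (auto simp: doubleton_eq_iff)

text \<open>Two routes of length two between opposite corners toggle the same two vertices in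
  opposite order, by \<open>flip_flip_eqD\<close>, so every 4-cycle is a square face of the
  hypercube.\<close>

lemma square:
  assumes "adj a b" "adj b c" "adj c d" "adj d a" "a \<noteq> c" "b \<noteq> d"
  obtains x y where "x \<noteq> y" "b = flip x a" "d = flip y a" "c = flip y (flip x a)"
proof -
  obtain x where x: "b = flip x a" using assms(1) unfolding adj_iff by blast
  obtain z where z: "c = flip z b" using assms(2) unfolding adj_iff by blast
  obtain w where w: "c = flip w d" using adj_sym[OF assms(3)] unfolding adj_iff by blast
  obtain y where y: "d = flip y a" using adj_sym[OF assms(4)] unfolding adj_iff by blast
  have "x \<noteq> y" "z \<noteq> x" using assms x y z by auto
  moreover have "z = y \<and> w = x"
    using flip_flip_eqD[of z x a w y] x y z w calculation by auto
  ultimately show thesis using that x y z by blast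
qed

text \<open>Opposite sides of the square toggle the same vertex \<open>x\<close>. The direction
  depends on whether \<open>x\<close> is already present, and crossing the square toggles only
  \<open>y\<close>, a different vertex.\<close>

lemma square_parallel:
  assumes "adj a b" "adj b c" "adj c d" "adj d a" "a \<noteq> c" "b \<noteq> d"
  shows "facet a b \<longleftrightarrow> facet d c"
proof -
  obtain x y where xy: "x \<noteq> y" "b = flip x a" "d = flip y a" "c = flip y (flip x a)"
    using square[OF assms] .
  have "c = flip x d" unfolding xy(3,4) by (rule flip_commute)
  then show ?thesis using assms xy adj_in facet_flip mem_flip by metis
qed

text \<open>The diamond property: the two vertices that lead from \<open>a\<close> to
  \<open>c\<close> can be added in the other order, and the new set is a simplex as a face of
  \<open>c\<close>.\<close>

lemma square_completion:
  assumes "facet a b" "facet b c"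
  obtains d where "d \<noteq> b" "facet a d" "facet d c"
proof -
  obtain x where x: "x \<notin> a" "b = insert x a" using assms(1) unfolding facet_iff by blast
  obtain y where y: "y \<notin> b" "c = insert y b" using assms(2) unfolding facet_iff by blast
  have "c \<in> K" "a \<in> K" using assms unfolding facet_iff by auto
  moreover have "insert y a \<in> K" by (rule face_in[OF \<open>c \<in> K\<close>]) (use x y in auto)
  moreover have c: "c = insert x (insert y a)" "y \<notin> a" "x \<noteq> y" using x y by auto
  moreover have "insert y a \<noteq> b" using c x by blast
  ultimately show thesis using that x(1) unfolding facet_iff by (metis insert_iff)
qed

text \<open>Deleting vertices one at a time walks from a simplex down to any chosen vertex of it.
  Adjacent vertices of \<open>K\<close> are linked through the simplex that they span.\<close>

lemma hasse_connected:
  assumes "\<sigma> \<in> K" "\<tau> \<in> K"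
  shows "(\<sigma>, \<tau>) \<in> {(a, b). adj a b}\<^sup>*" (is "_ \<in> ?A\<^sup>*")
proof -
  have symA: "sym (?A\<^sup>*)" by (rule sym_rtrancl) (auto simp: sym_def adj_sym)
  have down: "(\<rho>, {v}) \<in> ?A\<^sup>*" if "\<rho> \<in> K" "v \<in> \<rho>" for \<rho> v
    using that
  proof (induction "card \<rho>" arbitrary: \<rho> rule: less_induct)
    case less
    show ?case
    proof (cases "\<rho> = {v}")
      case False
      then obtain x where x: "x \<in> \<rho>" "x \<noteq> v" using less.prems by blast
      have K: "\<rho> - {x} \<in> K" by (rule face_in[OF less.prems(1)]) (use x less.prems in auto)
      have "facet (\<rho> - {x}) \<rho>" unfolding facet_iff using K less.prems x by blast
      then have "(\<rho>, \<rho> - {x}) \<in> ?A" "card (\<rho> - {x}) < card \<rho>"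
        using card_facet[of "\<rho> - {x}" \<rho>] by (simp_all add: adj_def)
      moreover have "(\<rho> - {x}, {v}) \<in> ?A\<^sup>*"
        using less.hyps[OF calculation(2) K] x less.prems by blast
      ultimately show ?thesis by (meson converse_rtrancl_into_rtrancl)
    qed simp
  qed
  obtain u v where uv: "u \<in> \<sigma>" "v \<in> \<tau>" using assms simplex_nonempty by blast
  have "(u, v) \<in> {(x, y). {x, y} \<in> K}\<^sup>*"
    using connected assms uv unfolding connected_complex_def by blast
  then have "({u}, {v}) \<in> ?A\<^sup>*"
  proof induction
    case (step y z)
    then have "{y, z} \<in> K" by simp
    then have "({y, z}, {y}) \<in> ?A\<^sup>*" "({y, z}, {z}) \<in> ?A\<^sup>*" using down by blast+
    then show ?case using step.IH symA by (meson rtrancl_trans symE)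
  qed simp
  then show ?thesis using down uv assms symA by (meson rtrancl_trans symE)
qed

text \<open>The empty set is not a node, so a neighbour of a vertex can only be an edge through it.
  Hence no node is adjacent to three distinct vertices.\<close>

lemma adj_singleton: "adj z {c} \<Longrightarrow> c \<in> z \<and> card z = 2"
  unfolding adj_def using card_facet[of "{c}" z] simplex_nonempty
  by (auto simp: facet_def numeral_2_eq_2)

end

section \<open>Automorphisms of the Hasse diagram preserve or reverse the face order\<close>

locale hasse_automorphism = connected_simplicial_complex K for K :: "'a set set" +
  fixes f :: "'a set \<Rightarrow> 'a set"
  assumes bij: "bij_betw f K K"
    and adj_image: "\<sigma> \<in> K \<Longrightarrow> \<tau> \<in> K \<Longrightarrow> adj (f \<sigma>) (f \<tau>) \<longleftrightarrow> adj \<sigma> \<tau>"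
begin

abbreviation up :: "'a set \<Rightarrow> 'a set \<Rightarrow> bool" where
  "up \<sigma> \<tau> \<equiv> facet (f \<sigma>) (f \<tau>)"

lemma image_in: "\<sigma> \<in> K \<Longrightarrow> f \<sigma> \<in> K"
  using bij bij_betw_apply by metis

lemma image_eq_iff: "\<sigma> \<in> K \<Longrightarrow> \<tau> \<in> K \<Longrightarrow> f \<sigma> = f \<tau> \<longleftrightarrow> \<sigma> = \<tau>"
  using bij by (meson bij_betw_def inj_on_eq_iff)

lemma surj_obtain:
  assumes "\<rho> \<in> K"
  obtains \<sigma> where "\<sigma> \<in> K" "f \<sigma> = \<rho>"
  using assms bij by (metis bij_betw_def imageE)

lemma not_up: "adj \<sigma> \<tau> \<Longrightarrow> \<not> up \<sigma> \<tau> \<longleftrightarrow> up \<tau> \<sigma>"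
  using adj_image adj_in facet_asym unfolding adj_def by metis

lemma up_parallel:
  assumes "adj a b" "adj b c" "adj c d" "adj d a" "a \<noteq> c" "b \<noteq> d"
  shows "up a b \<longleftrightarrow> up d c"
  by (rule square_parallel) (use assms adj_in in \<open>auto simp: adj_image image_eq_iff\<close>)

lemma image_square:
  assumes "facet b a" "facet d a" "facet c b" "facet c d" "b \<noteq> d"
  obtains x y where "x \<noteq> y" "f b = flip x (f a)" "f d = flip y (f a)" "f c = flip y (flip x (f a))"
proof (rule square)
  have in_K: "a \<in> K" "b \<in> K" "c \<in> K" "d \<in> K" and "c \<noteq> a"
    using assms unfolding facet_def by auto
  then show "f a \<noteq> f c" "f b \<noteq> f d" using assms(5) by (auto simp: image_eq_iff)
  show "adj (f a) (f b)" "adj (f b) (f c)" "adj (f c) (f d)" "adj (f d) (f a)"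
    using assms in_K by (simp_all add: adj_image) (simp_all add: adj_def)
qed

text \<open>\<open>u\<close> with or without \<open>x\<close> and \<open>y\<close> gives the corners
  of a square, so a direction can be carried to the parallel edge. Nonemptiness of \<open>u\<close>
  makes all four corners nodes.\<close>

lemma up_insert:
  assumes "insert x (insert y u) \<in> K" "u \<noteq> {}" "x \<noteq> y" "x \<notin> u" "y \<notin> u"
  shows "up u (insert x u) \<longleftrightarrow> up (insert y u) (insert x (insert y u))"
proof -
  have K: "u \<in> K" "insert x u \<in> K" "insert y u \<in> K"
    by (rule face_in[OF assms(1)]; use assms in auto)+
  have "facet u (insert x u)" "facet u (insert y u)" "facet (insert x u) (insert x (insert y u))"
    "facet (insert y u) (insert x (insert y u))"
    unfolding facet_iff using K assms by auto
  then show ?thesis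
    by (intro up_parallel) (use assms in \<open>auto simp: adj_def\<close>)
qed

text \<open>
  The images of the proper faces of a triangle and of the triangle itself are seven vertices of a
  3-cube. If the three edges at the image \<open>T\<close> of the triangle do not all point the same way, then
  the eighth vertex is a simplex as well, and its preimage has all three vertices of the triangle as
  facets, which is absurd for an edge.
\<close>

lemma up_triangle_aux:
  assumes K: "{c, x, y} \<in> K" and "c \<noteq> x" "c \<noteq> y" "x \<noteq> y"
    and up: "up {c, y} {c, x, y}" and dn: "\<not> up {c, x} {c, x, y}"
  shows False
proof -
  define T where "T = f {c, x, y}"
  have sub: "\<sigma> \<in> K" if "\<sigma> \<subseteq> {c, x, y}" "\<sigma> \<noteq> {}" for \<sigma> using face_in K that by blast
  have in_K: "{c} \<in> K" "{x} \<in> K" "{y} \<in> K" "{c, x} \<in> K" "{c, y} \<in> K" "{x, y} \<in> K"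
    by (auto intro!: sub)
  have fac: "facet {c, x} {c, x, y}" "facet {c, y} {c, x, y}" "facet {x, y} {c, x, y}"
    "facet {c} {c, x}" "facet {c} {c, y}" "facet {x} {c, x}" "facet {x} {x, y}"
    "facet {y} {c, y}" "facet {y} {x, y}"
    unfolding facet_card_iff using in_K K assms(2-4) by auto
  \<comment> \<open>Each vertex of the triangle is the bottom of a square with the triangle on top.
    The three squares name the directions \<open>i\<close>, \<open>j\<close>, \<open>k\<close> of
    the edges at \<open>T\<close>; the two names that each direction receives agree by
    \<open>flip_eq_iff\<close>.\<close>
  obtain i j where ij: "i \<noteq> j" "f {c, y} = flip i T" "f {c, x} = flip j T" "f {c} = flip j (flip i T)"
    using image_square[OF fac(2,1,5,4)] assms(4) unfolding T_def by (metis doubleton_eq_iff)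
  obtain j' k where jk: "j' \<noteq> k" "f {c, x} = flip j' T" "f {x, y} = flip k T" "f {x} = flip k (flip j' T)"
    using image_square[OF fac(1,3,6,7)] assms(3) unfolding T_def by (metis doubleton_eq_iff)
  obtain i' k' where ik: "i' \<noteq> k'" "f {c, y} = flip i' T" "f {x, y} = flip k' T" "f {y} = flip k' (flip i' T)"
    using image_square[OF fac(2,3,8,9)] assms(2) unfolding T_def by (metis doubleton_eq_iff)
  have [simp]: "j' = j" "i' = i" "k' = k" using ij jk ik by simp_all
  have TK: "T \<in> K" unfolding T_def using K image_in by blast
  have i: "i \<in> T" using up ij(2) facet_flip[of "flip i T" i] TK unfolding T_def[symmetric] by simp
  have "up {c, x, y} {c, x}" using dn fac not_up unfolding adj_def by metis
  then have j: "j \<notin> T" using ij(3) facet_flip[of T j] unfolding T_def[symmetric] by simp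
  \<comment> \<open>The eighth corner of the cube, opposite to \<open>T\<close>.\<close>
  define Z where "Z = flip k (flip j (flip i T))"
  have kj: "k \<noteq> i" "k \<noteq> j" using jk ik by auto
  have "j \<in> Z" using j kj ij(1) unfolding Z_def by auto
  \<comment> \<open>Passing from \<open>f {x}\<close> to \<open>Z\<close> toggles \<open>i\<close>,
    which lies in \<open>T\<close> and so is deleted; passing from \<open>f {c}\<close> to
    \<open>Z\<close> toggles \<open>k\<close>, which is deleted if it lies in \<open>T\<close>. So
    \<open>Z\<close> is a face of a simplex, and \<open>j\<close> keeps it nonempty.\<close>
  moreover have "Z \<subseteq> f {c} \<or> Z \<subseteq> f {x}"
  proof (cases "k \<in> T")
    case True
    then have "Z \<subseteq> f {c}" unfolding Z_def ij using kj ij(1) by auto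
    then show ?thesis ..
  next
    case False
    have "Z \<subseteq> f {x}" unfolding Z_def jk using i kj ij(1) by auto
    then show ?thesis ..
  qed
  ultimately have "Z \<in> K" using face_in image_in in_K by blast
  then obtain z where z: "z \<in> K" "f z = Z" using surj_obtain by blast
  have "Z = flip k (f {c})" "Z = flip i (f {x})" "Z = flip j (f {y})"
    unfolding Z_def ij jk ik by (auto simp: set_eq_iff)
  then have "adj (f {c}) Z" "adj (f {x}) Z" "adj (f {y}) Z"
    unfolding adj_iff using image_in in_K \<open>Z \<in> K\<close> by blast+
  then have "adj z {c}" "adj z {x}" "adj z {y}" using adj_image z in_K adj_sym by metis+
  then have "{c, x, y} \<subseteq> z" "card z = 2" using adj_singleton by auto
  then have "card {c, x, y} \<le> 2" by (metis card_mono card.infinite zero_neq_numeral)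
  then show False using assms(2-4) by simp
qed

text \<open>Deleting a vertex of \<open>u\<close> carries both edges to parallel ones in lower
  dimension, by \<open>up_insert\<close>. The claim thus descends to a single vertex
  \<open>{c}\<close>, where both edges lie in one triangle and \<open>up_triangle_aux\<close>
  excludes a disagreement.\<close>

lemma up_insert_insert:
  assumes "insert x (insert y u) \<in> K" "u \<noteq> {}" "x \<noteq> y" "x \<notin> u" "y \<notin> u"
  shows "up u (insert x u) \<longleftrightarrow> up u (insert y u)"
  using assms
proof (induction "card u" arbitrary: u rule: less_induct)
  case less
  obtain c where c: "c \<in> u" using less.prems by blast
  have fin: "finite u" using finite_simplex[OF less.prems(1)] by simp
  show ?case
  proof (cases "u = {c}")
    case True
    have ne: "c \<noteq> x" "c \<noteq> y" "x \<noteq> y" and K: "{c, x, y} \<in> K" "{c, y, x} \<in> K"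
      using less.prems True by (auto simp: insert_commute)
    have "up {c} {c, x} \<longleftrightarrow> up {c, y} {c, x, y}" "up {c} {c, y} \<longleftrightarrow> up {c, x} {c, x, y}"
      using up_insert[of x y "{c}"] up_insert[of y x "{c}"] ne K by (simp_all add: insert_commute)
    moreover have "up {c, y} {c, x, y} \<longleftrightarrow> up {c, x} {c, x, y}"
      using up_triangle_aux[of c x y] up_triangle_aux[of c y x] ne K by (auto simp: insert_commute)
    ultimately show ?thesis using True by (simp add: insert_commute)
  next
    case False
    let ?v = "u - {c}"
    have v: "?v \<noteq> {}" "card ?v < card u" using c False card_Diff1_less[OF fin c] by auto
    have in_K: "insert x (insert y ?v) \<in> K" "insert x u \<in> K" "insert y u \<in> K"
      by (rule face_in[OF less.prems(1)]; auto)+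
    have eq: "insert c ?v = u" using c by blast
    have "up ?v (insert x ?v) \<longleftrightarrow> up u (insert x u)"
      using up_insert[of x c ?v] eq in_K v c less.prems by auto
    moreover have "up ?v (insert y ?v) \<longleftrightarrow> up u (insert y u)"
      using up_insert[of y c ?v] eq in_K v c less.prems by auto
    ultimately show ?thesis using less.hyps[of ?v] v in_K less.prems by auto
  qed
qed

text \<open>\<open>up_insert_insert\<close> needs a simplex above both \<open>b\<close> and
  \<open>d\<close>, and a disagreement supplies one: \<open>f a\<close> then lies strictly between
  the two images, and the preimage of the other middle node of that diamond is the union of
  \<open>b\<close> and \<open>d\<close>.\<close>

lemma up_cofacets:
  assumes "facet a b" "facet a d"
  shows "up a b \<longleftrightarrow> up a d"
proof -
  have "\<not> (up a b \<and> \<not> up a d)" if ab: "facet a b" and ad: "facet a d" for b d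
  proof
    assume *: "up a b \<and> \<not> up a d"
    then have "up d a" using not_up ad unfolding adj_def by blast
    with * obtain e where e: "e \<noteq> f a" "facet (f d) e" "facet e (f b)"
      using square_completion by blast
    then have "e \<in> K" unfolding facet_def by blast
    then obtain e' where e': "e' \<in> K" "f e' = e" using surj_obtain by blast
    have in_K: "a \<in> K" "b \<in> K" "d \<in> K" using ab ad unfolding facet_def by auto
    have "adj b e'" "adj e' d" using e e' adj_image in_K unfolding adj_def by blast+
    moreover have "a \<noteq> e'" "b \<noteq> d" using * e e' by auto
    ultimately obtain x y where xy: "x \<noteq> y" "b = flip x a" "d = flip y a" "e' = flip y (flip x a)"
      using square[of a b e' d] ab ad unfolding adj_def by metis
    then have "x \<notin> a" "y \<notin> a" using ab ad facet_flip by auto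
    moreover have "b = insert x a" "d = insert y a" "e' = insert x (insert y a)"
      using xy calculation by (auto simp: flip_def)
    moreover have "a \<noteq> {}" using simplex_nonempty in_K by blast
    ultimately show False using up_insert_insert[of x y a] e' xy(1) * by auto
  qed
  then show ?thesis using assms by blast
qed

lemma up_chain:
  assumes "facet a b" "facet b c"
  shows "up a b \<longleftrightarrow> up b c"
proof -
  obtain d where d: "d \<noteq> b" "facet a d" "facet d c" using square_completion assms by blast
  have "up a d \<longleftrightarrow> up b c"
    by (rule up_parallel) (use d assms in \<open>auto simp: adj_def facet_def\<close>)
  then show ?thesis using up_cofacets assms d by blast
qed

text \<open>Dual to \<open>up_cofacets\<close>. The intersection of \<open>b\<close> and
  \<open>d\<close> could be empty and hence not a node, but a disagreement again produces a fourth
  corner, which must be that intersection, and \<open>up_insert_insert\<close> applies to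
  it.\<close>

lemma up_facets:
  assumes "facet b a" "facet d a"
  shows "up b a \<longleftrightarrow> up d a"
proof -
  have "\<not> (up b a \<and> \<not> up d a)" if ba: "facet b a" and da: "facet d a" for b d
  proof
    assume *: "up b a \<and> \<not> up d a"
    then have "up a d" using not_up da unfolding adj_def by blast
    with * obtain e where e: "e \<noteq> f a" "facet (f b) e" "facet e (f d)"
      using square_completion by blast
    then have "e \<in> K" unfolding facet_def by blast
    then obtain e' where e': "e' \<in> K" "f e' = e" using surj_obtain by blast
    have in_K: "a \<in> K" "b \<in> K" "d \<in> K" using ba da unfolding facet_def by auto
    have "adj b e'" "adj e' d" using e e' adj_image in_K unfolding adj_def by blast+
    moreover have "a \<noteq> e'" "b \<noteq> d" using * e e' by auto
    ultimately obtain x y where xy: "x \<noteq> y" "b = flip x a" "d = flip y a" "e' = flip y (flip x a)"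
      using square[of a b e' d] ba da unfolding adj_def by metis
    have "facet b (flip x b)" "facet d (flip y d)" using ba da xy by auto
    then have "x \<in> a" "y \<in> a" unfolding facet_flip using xy by auto
    then have "b = a - {x}" "d = a - {y}" "e' = a - {x, y}"
      using xy(1) unfolding xy(2-4) by (auto simp: flip_def)
    then have "b = insert y e'" "d = insert x e'" "a = insert x (insert y e')" "x \<notin> e'" "y \<notin> e'"
      using \<open>x \<in> a\<close> \<open>y \<in> a\<close> xy(1) by blast+
    moreover have "e' \<noteq> {}" using simplex_nonempty e' by blast
    ultimately show False
      using up_insert_insert[of x y e'] up_insert[of x y e'] up_insert[of y x e'] in_K xy(1) *
      by (auto simp: insert_commute)
  qed
  then show ?thesis using assms by blast
qed

text \<open>Two edges that share a node are compared by \<open>up_cofacets\<close>,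
  \<open>up_chain\<close> or \<open>up_facets\<close>, so the direction spreads along the paths of
  the connected diagram.\<close>

lemma up_const:
  assumes "facet a b" "facet c d"
  shows "up a b \<longleftrightarrow> up c d"
proof -
  have "(a, c) \<in> {(a, b). adj a b}\<^sup>*" using hasse_connected assms unfolding facet_def by blast
  then have "\<forall>\<sigma> \<tau>. facet \<sigma> \<tau> \<and> (\<sigma> = c \<or> \<tau> = c) \<longrightarrow> (up \<sigma> \<tau> \<longleftrightarrow> up a b)"
  proof induction
    case base
    then show ?case using assms(1) up_cofacets up_chain by metis
  next
    case (step y z)
    then consider "facet y z" | "facet z y" unfolding adj_def by blast
    then show ?case
      by cases (metis step.IH up_cofacets up_chain up_facets)+
  qed
  then show ?thesis using assms by blast
qed

theorem preserves_or_reverses: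
  "(\<forall>\<sigma> \<tau>. facet \<sigma> \<tau> \<longrightarrow> facet (f \<sigma>) (f \<tau>)) \<or> (\<forall>\<sigma> \<tau>. facet \<sigma> \<tau> \<longrightarrow> facet (f \<tau>) (f \<sigma>))"
  using up_const not_up unfolding adj_def by metis

end

lemma acyclic_inv_imageI:
  assumes "acyclic r"
  shows "acyclic (inv_image r h)"
proof -
  have "(h x, h y) \<in> r\<^sup>+" if "(x, y) \<in> (inv_image r h)\<^sup>+" for x y
    using that by induction (auto simp: in_inv_image intro: trancl_into_trancl)
  then show ?thesis using assms unfolding acyclic_def by blast
qed

section \<open>Edge permutations of triangle-free graphs\<close>

definition ends :: "'v \<times> 'v \<Rightarrow> 'v set" where
  "ends e = {fst e, snd e}"

definition star :: "('v \<times> 'v) set \<Rightarrow> 'v \<Rightarrow> ('v \<times> 'v) set" where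
  "star E v = {e \<in> E. v \<in> ends e}"

text \<open>\<open>branching_end\<close> excludes isolated edges, whose two ends have the same star;
  \<open>no_isolated\<close> allows an isolated node only as the sole node. Together they let a node
  be recovered from its star.\<close>

locale triangle_free_graph =
  fixes N :: "'v set" and E :: "('v \<times> 'v) set"
  assumes finite_nodes: "finite N"
    and ends_nodes: "e \<in> E \<Longrightarrow> ends e \<subseteq> N"
    and no_loop: "e \<in> E \<Longrightarrow> fst e \<noteq> snd e"
    and inj_ends: "inj_on ends E"
    and triangle_free: "{u, v} \<in> ends ` E \<Longrightarrow> {v, w} \<in> ends ` E \<Longrightarrow> {w, u} \<notin> ends ` E"
    and branching_end: "e \<in> E \<Longrightarrow> \<exists>v e'. {e, e'} \<subseteq> star E v \<and> e \<noteq> e'"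
    and no_isolated: "u \<in> N \<Longrightarrow> v \<in> N \<Longrightarrow> u \<noteq> v \<Longrightarrow> star E u \<noteq> {}"
begin

lemma ends_eqI: "e \<in> E \<Longrightarrow> u \<in> ends e \<Longrightarrow> v \<in> ends e \<Longrightarrow> u \<noteq> v \<Longrightarrow> ends e = {u, v}"
  unfolding ends_def by auto

lemma two_common_ends:
  assumes "e \<in> E" "e' \<in> E" "u \<noteq> v" "{u, v} \<subseteq> ends e" "{u, v} \<subseteq> ends e'"
  shows "e = e'"
proof -
  have "ends e = ends e'" using assms ends_eqI[of e u v] ends_eqI[of e' u v] by simp
  then show ?thesis using inj_ends assms(1,2) by (meson inj_onD)
qed

text \<open>If two nodes had the same star, each of its edges would join them, so it would be a
  single edge without a branching end.\<close>

lemma inj_star: "inj_on (star E) N"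
proof (rule inj_onI, rule ccontr)
  fix u v assume uv: "u \<in> N" "v \<in> N" "star E u = star E v" "u \<noteq> v"
  then obtain e where e: "e \<in> star E u" using no_isolated by blast
  then have all: "e' = e" if "e' \<in> star E u" for e'
    using that uv two_common_ends[of e' e u v] unfolding star_def by auto
  have eE: "e \<in> E" and "u \<in> ends e" "v \<in> ends e" using e uv(3) unfolding star_def by auto
  then have "ends e = {u, v}" using uv(4) by (rule ends_eqI)
  then obtain w e' where "{e, e'} \<subseteq> star E w" "e \<noteq> e'" using branching_end[OF eE] by blast
  moreover then have "w \<in> {u, v}" using \<open>ends e = {u, v}\<close> unfolding star_def by auto
  ultimately show False using all[of e'] uv(3) by auto
qed

text \<open>If the images of two star edges meet in \<open>w\<close> and a third image misses
  \<open>w\<close>, the three images form a triangle.\<close>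

lemma star_image_subset:
  assumes p: "bij_betw p E E"
    and meet: "\<And>e e'. e \<in> E \<Longrightarrow> e' \<in> E \<Longrightarrow> ends e \<inter> ends e' \<noteq> {} \<Longrightarrow> ends (p e) \<inter> ends (p e') \<noteq> {}"
    and e12: "e1 \<in> star E v" "e2 \<in> star E v" "e1 \<noteq> e2"
  obtains w where "w \<in> N" "p ` star E v \<subseteq> star E w"
proof -
  have pE: "p e \<in> E" if "e \<in> E" for e using p that by (rule bij_betw_apply)
  have inj: "p e \<noteq> p e'" if "e \<in> E" "e' \<in> E" "e \<noteq> e'" for e e'
    using p that by (meson bij_betw_def inj_on_eq_iff)
  have E: "e1 \<in> E" "e2 \<in> E" using e12 unfolding star_def by auto
  have meet': "ends (p e) \<inter> ends (p e') \<noteq> {}" if "e \<in> star E v" "e' \<in> star E v" for e e'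
    using meet[of e e'] that unfolding star_def by blast
  obtain w where w: "w \<in> ends (p e1)" "w \<in> ends (p e2)" using meet'[OF e12(1,2)] by blast
  have "w \<in> ends (p e)" if e: "e \<in> star E v" for e
  proof (rule ccontr)
    assume nw: "w \<notin> ends (p e)"
    obtain a where a: "a \<in> ends (p e)" "a \<in> ends (p e1)" using meet'[OF e e12(1)] by blast
    obtain b where b: "b \<in> ends (p e)" "b \<in> ends (p e2)" using meet'[OF e e12(2)] by blast
    have ne: "a \<noteq> w" "b \<noteq> w" using nw a b by auto
    have eE: "e \<in> E" using e unfolding star_def by blast
    have "a \<noteq> b"
      using two_common_ends[of "p e1" "p e2" a w] w a b ne E pE inj[OF E e12(3)] by auto
    then have "ends (p e) = {a, b}" "ends (p e1) = {w, a}" "ends (p e2) = {b, w}"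
      using ends_eqI a b w ne E eE pE by metis+
    then show False using triangle_free[of w a b] E eE pE by (metis imageI)
  qed
  then have "p ` star E v \<subseteq> star E w" using pE unfolding star_def by auto
  moreover have "w \<in> N" using ends_nodes[OF pE[OF E(1)]] w by blast
  ultimately show thesis using that by blast
qed

text \<open>
  Whitney's edge isomorphism theorem, in the case without triangles: a maximal set of at least two
  pairwise intersecting edges is a star.
\<close>

theorem edge_automorphism_induced:
  assumes p: "bij_betw p E E"
    and meet: "\<And>e e'. e \<in> E \<Longrightarrow> e' \<in> E \<Longrightarrow> ends (p e) \<inter> ends (p e') \<noteq> {} \<longleftrightarrow> ends e \<inter> ends e' \<noteq> {}"
  obtains f where "bij_betw f N N" "\<And>e. e \<in> E \<Longrightarrow> ends (p e) = f ` ends e"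
proof -
  define q where "q = inv_into E p"
  have q: "bij_betw q E E" unfolding q_def by (rule bij_betw_inv_into[OF p])
  have pq: "p (q e) = e" and qp: "q (p e) = e" and qE: "q e \<in> E" and pE: "p e \<in> E" if "e \<in> E" for e
    using that p q unfolding q_def
    by (auto simp: bij_betw_inv_into_left bij_betw_inv_into_right bij_betw_apply)
  have meet_q: "ends (q e) \<inter> ends (q e') \<noteq> {}" if "e \<in> E" "e' \<in> E" "ends e \<inter> ends e' \<noteq> {}" for e e'
    using meet[of "q e" "q e'"] that pq qE by simp
  have starE: "star E v \<subseteq> E" for v unfolding star_def by blast
  \<comment> \<open>The inverse \<open>q\<close> sends the star of \<open>w\<close> into the star of
    some \<open>v'\<close>. The edges \<open>e1\<close> and \<open>e2\<close> have both
    \<open>v\<close> and \<open>v'\<close> as ends, so \<open>v' = v\<close>, and the inclusion of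
    stars becomes an equality.\<close>
  have branching: "\<exists>w\<in>N. p ` star E v = star E w"
    if e12: "e1 \<in> star E v" "e2 \<in> star E v" "e1 \<noteq> e2" for e1 e2 v
  proof -
    obtain w where w: "w \<in> N" "p ` star E v \<subseteq> star E w"
      using star_image_subset[OF p _ e12] meet by blast
    have "p e1 \<in> star E w" "p e2 \<in> star E w" using w e12 by auto
    moreover have "p e1 \<noteq> p e2" using qp e12 starE by (metis subsetD)
    ultimately obtain v' where v': "v' \<in> N" "q ` star E w \<subseteq> star E v'"
      using star_image_subset[OF q meet_q] by blast
    have "e1 = q (p e1)" "e2 = q (p e2)" using qp e12 starE by (metis subsetD)+
    then have "e1 \<in> star E v'" "e2 \<in> star E v'"
      using v' \<open>p e1 \<in> star E w\<close> \<open>p e2 \<in> star E w\<close> by blast+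
    then have "v' = v" using two_common_ends[of e1 e2 v v'] e12 unfolding star_def by auto
    have "star E w \<subseteq> p ` star E v"
    proof
      fix e assume "e \<in> star E w"
      then have "q e \<in> star E v" "p (q e) = e" using v' \<open>v' = v\<close> pq starE by blast+
      then show "e \<in> p ` star E v" by (metis imageI)
    qed
    then show ?thesis using w by blast
  qed
  have ex: "\<exists>w\<in>N. p ` star E v = star E w" if v: "v \<in> N" for v
  proof -
    consider "star E v = {}" | e where "star E v = {e}"
      | e1 e2 where "e1 \<in> star E v" "e2 \<in> star E v" "e1 \<noteq> e2" by blast
    then show ?thesis
    proof cases
      case 1
      then show ?thesis using v by auto
    next
      \<comment> \<open>Here \<open>v\<close> is a leaf. Its neighbour \<open>u\<close> branches, so
        the star of \<open>u\<close> goes to the star of some \<open>a\<close>. The other end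
        \<open>b\<close> of \<open>p e\<close> is the candidate for the image of \<open>v\<close>
        and must be shown to be a leaf.\<close>
      case (2 e)
      then have eE: "e \<in> E" and ve: "v \<in> ends e" unfolding star_def by auto
      obtain u e' where u: "e \<in> star E u" "e' \<in> star E u" "e \<noteq> e'"
        using branching_end[OF eE] by blast
      have "u \<noteq> v" using u 2 by auto
      obtain a where a: "a \<in> N" "p ` star E u = star E a" using branching u by blast
      then have "a \<in> ends (p e)" using u(1) unfolding star_def by blast
      then obtain b where b: "ends (p e) = {a, b}" "a \<noteq> b"
        using no_loop[OF pE[OF eE]] unfolding ends_def by (metis empty_iff insert_commute insert_iff)
      have bN: "b \<in> N" using ends_nodes[OF pE[OF eE]] b by blast
      have "star E b = {p e}"
      proof (rule ccontr)
        assume "star E b \<noteq> {p e}"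
        moreover have peb: "p e \<in> star E b" using b pE[OF eE] unfolding star_def by simp
        ultimately obtain g where g: "g \<in> star E b" "g \<noteq> p e" by blast
        \<comment> \<open>The second edge \<open>g\<close> at \<open>b\<close> pulls back to an edge
          that meets \<open>e\<close> at a node other than the leaf \<open>v\<close>, that is at
          \<open>u\<close>. Then \<open>g\<close> passes through \<open>a\<close> as well and
          coincides with \<open>p e\<close>.\<close>
        obtain v' where v': "q ` star E b \<subseteq> star E v'"
          using star_image_subset[OF q meet_q peb g(1)] g(2) by blast
        have gE: "g \<in> E" using g starE by blast
        have "q (p e) \<in> star E v'" "q g \<in> star E v'" using v' peb g by blast+
        then have ev': "e \<in> star E v'" "q g \<in> star E v'" using qp[OF eE] by simp_all
        moreover have "q g \<noteq> e" using g(2) pq[OF gE] by metis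
        ultimately have "v' \<noteq> v" using 2 by auto
        have "ends e = {u, v}" using u(1) ve \<open>u \<noteq> v\<close> ends_eqI[OF eE] unfolding star_def by blast
        then have "v' = u" using ev'(1) \<open>v' \<noteq> v\<close> unfolding star_def by auto
        then have "p (q g) \<in> star E a" using ev'(2) a(2) by blast
        then have "g \<in> star E a" using pq[OF gE] by simp
        then have "g = p e"
          using two_common_ends[of g "p e" a b] b g pE[OF eE] unfolding star_def by auto
        with g show False by simp
      qed
      then show ?thesis using 2 bN by auto
    next
      case 3
      then show ?thesis using branching by blast
    qed
  qed
  define f where "f v = (SOME w. w \<in> N \<and> p ` star E v = star E w)" for v
  have f: "f v \<in> N" "p ` star E v = star E (f v)" if "v \<in> N" for v
    using someI_ex[of "\<lambda>w. w \<in> N \<and> p ` star E v = star E w"] ex[OF that] unfolding f_def by blast+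
  have "inj_on f N"
  proof (rule inj_onI)
    fix u v assume uv: "u \<in> N" "v \<in> N" "f u = f v"
    then have "p ` star E u = p ` star E v" using f by simp
    then have "star E u = star E v"
      using p starE by (meson bij_betw_def inj_on_image_eq_iff)
    then show "u = v" using uv inj_star by (meson inj_onD)
  qed
  then have bij: "bij_betw f N N"
    using f(1) finite_nodes by (simp add: bij_betw_def endo_inj_surj image_subset_iff)
  have "ends (p e) = f ` ends e" if e: "e \<in> E" for e
  proof -
    have "f v \<in> ends (p e)" if "v \<in> ends e" for v
    proof -
      have "e \<in> star E v" "v \<in> N" using that e ends_nodes[OF e] unfolding star_def by auto
      then have "p e \<in> star E (f v)" using f(2) by blast
      then show ?thesis unfolding star_def by simp
    qed
    then have sub: "{f (fst e), f (snd e)} \<subseteq> ends (p e)" unfolding ends_def by simp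
    moreover have "f (fst e) \<noteq> f (snd e)"
      using \<open>inj_on f N\<close> ends_nodes[OF e] no_loop[OF e] unfolding ends_def
      by (simp add: inj_on_eq_iff)
    ultimately show ?thesis unfolding ends_def by auto
  qed
  with bij show thesis using that by blast
qed

end

section \<open>The Morse complex as the complex of acyclic matchings of the Hasse diagram\<close>

context connected_simplicial_complex
begin

definition pairs :: "('a set \<times> 'a set) set" where
  "pairs = {(\<sigma>, \<tau>). facet \<sigma> \<tau>}"

lemma mem_pairs [simp]: "(\<sigma>, \<tau>) \<in> pairs \<longleftrightarrow> facet \<sigma> \<tau>"
  unfolding pairs_def by simp

lemma pairs_facet: "e \<in> pairs \<Longrightarrow> facet (fst e) (snd e)"
  unfolding pairs_def by auto

lemma Union_morse: "\<Union>(morse_complex K) = pairs"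
  unfolding Union_morse_complex pairs_def facet_def ..

lemma ends_adj: "{\<sigma>, \<tau>} \<in> ends ` pairs \<longleftrightarrow> adj \<sigma> \<tau>"
proof
  assume "{\<sigma>, \<tau>} \<in> ends ` pairs"
  then show "adj \<sigma> \<tau>" unfolding ends_def adj_def by (auto simp: doubleton_eq_iff dest: pairs_facet)
next
  assume "adj \<sigma> \<tau>"
  then have "(\<sigma>, \<tau>) \<in> pairs \<or> (\<tau>, \<sigma>) \<in> pairs" unfolding adj_def by simp
  moreover have "ends (\<sigma>, \<tau>) = {\<sigma>, \<tau>}" "ends (\<tau>, \<sigma>) = {\<sigma>, \<tau>}" unfolding ends_def by auto
  ultimately show "{\<sigma>, \<tau>} \<in> ends ` pairs" by (metis imageI)
qed

lemma inj_ends_pairs: "inj_on ends pairs"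
  by (rule inj_onI)
    (auto simp: ends_def doubleton_eq_iff prod_eq_iff dest!: pairs_facet dest: facet_asym)

lemma finite_pairs: "finite K \<Longrightarrow> finite pairs"
  by (rule finite_subset[of _ "K \<times> K"]) (auto simp: pairs_def facet_def)

text \<open>Parity of the cardinality makes the diagram bipartite. The larger simplex of an edge has
  at least two vertices, hence a second facet, so the edge branches there. Connectedness excludes an
  isolated node beside others.\<close>

lemma triangle_free_hasse:
  assumes "finite K"
  shows "triangle_free_graph K pairs"
proof
  show "finite K" by fact
  show "ends e \<subseteq> K" "fst e \<noteq> snd e" if "e \<in> pairs" for e
    using pairs_facet[OF that] unfolding ends_def facet_def by auto
  show "inj_on ends pairs" by (rule inj_ends_pairs)
  show "{w, u} \<notin> ends ` pairs" if "{u, v} \<in> ends ` pairs" "{v, w} \<in> ends ` pairs" for u v w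
  proof
    assume "{w, u} \<in> ends ` pairs"
    moreover have "even (card \<sigma>) \<longleftrightarrow> odd (card \<tau>)" if "adj \<sigma> \<tau>" for \<sigma> \<tau>
      using that card_facet unfolding adj_def by fastforce
    ultimately show False using that unfolding ends_adj by blast
  qed
  show "\<exists>v e'. {e, e'} \<subseteq> star pairs v \<and> e \<noteq> e'" if e: "e \<in> pairs" for e
  proof -
    obtain \<sigma> \<tau> where st: "e = (\<sigma>, \<tau>)" "facet \<sigma> \<tau>" using e pairs_facet by (metis prod.collapse)
    then obtain x where x: "\<sigma> \<in> K" "\<tau> \<in> K" "x \<notin> \<sigma>" "\<tau> = insert x \<sigma>" unfolding facet_iff by blast
    obtain y where y: "y \<in> \<sigma>" using simplex_nonempty x by blast
    have "\<tau> - {y} \<in> K" by (rule face_in[OF x(2)]) (use x y in auto)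
    then have "facet (\<tau> - {y}) \<tau>" unfolding facet_iff using x y by blast
    then show ?thesis
      using st x y by (intro exI[of _ \<tau>] exI[of _ "(\<tau> - {y}, \<tau>)"]) (auto simp: star_def ends_def)
  qed
  show "star pairs u \<noteq> {}" if "u \<in> K" "v \<in> K" "u \<noteq> v" for u v
  proof -
    have "(u, v) \<in> {(a, b). adj a b}\<^sup>*" using that hasse_connected by blast
    then obtain w where "adj u w" using \<open>u \<noteq> v\<close> by (auto elim: converse_rtranclE)
    then have "(u, w) \<in> star pairs u \<or> (w, u) \<in> star pairs u"
      unfolding adj_def star_def ends_def by auto
    then show ?thesis by blast
  qed
qed

lemma Union_facets:
  assumes "facet \<alpha> \<beta>" "facet \<alpha>' \<beta>" "\<alpha> \<noteq> \<alpha>'"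
  shows "\<alpha> \<union> \<alpha>' = \<beta>"
proof -
  obtain x where x: "x \<notin> \<alpha>" "\<beta> = insert x \<alpha>" using assms(1) unfolding facet_iff by blast
  obtain x' where x': "x' \<notin> \<alpha>'" "\<beta> = insert x' \<alpha>'" using assms(2) unfolding facet_iff by blast
  have "x \<noteq> x'" using x x' assms(3) by (metis insert_ident)
  then show ?thesis using x x' by blast
qed

text \<open>A step of a V-path, viewed as a step from one regular pair to the next.\<close>

definition flow :: "('a set \<times> 'a set) set \<Rightarrow> (('a set \<times> 'a set) \<times> ('a set \<times> 'a set)) set" where
  "flow V = {(e, e'). e \<in> V \<and> e' \<in> V \<and> e \<noteq> e' \<and> facet (fst e') (snd e)}"

definition matching :: "('a set \<times> 'a set) set \<Rightarrow> bool" where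
  "matching V \<longleftrightarrow> V \<subseteq> pairs \<and> (\<forall>e\<in>V. \<forall>e'\<in>V. e \<noteq> e' \<longrightarrow> ends e \<inter> ends e' = {})"

lemma discrete_vector_field_iff: "discrete_vector_field K V \<longleftrightarrow> matching V"
proof
  assume V: "discrete_vector_field K V"
  then have "V \<subseteq> pairs" unfolding discrete_vector_field_def pairs_def facet_def by auto
  moreover have "ends e \<inter> ends e' = {}" if e: "e \<in> V" "e' \<in> V" "e \<noteq> e'" for e e'
  proof (rule ccontr)
    assume "ends e \<inter> ends e' \<noteq> {}"
    then obtain \<rho> where "\<rho> \<in> ends e" "\<rho> \<in> ends e'" by blast
    moreover then have "\<rho> \<in> K"
      using e \<open>V \<subseteq> pairs\<close> pairs_facet unfolding ends_def facet_def by blast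
    ultimately show False using V e unfolding discrete_vector_field_def ends_def by blast
  qed
  ultimately show "matching V" unfolding matching_def by blast
next
  assume "matching V"
  then show "discrete_vector_field K V"
    unfolding discrete_vector_field_def matching_def pairs_def facet_def ends_def by blast
qed

text \<open>A pair of a matching is determined by its smaller simplex, so a closed V-path amounts to
  a cyclic sequence of pairs, that is, a cycle of \<open>flow V\<close>.\<close>

lemma gradient_iff: "gradient_vector_field K V \<longleftrightarrow> matching V \<and> acyclic (flow V)"
proof (cases "matching V")
  case V: True
  then have sub: "V \<subseteq> pairs" unfolding matching_def by blast
  have same_fst: "e = e'" if "e \<in> V" "e' \<in> V" "fst e = fst e'" for e e'
    using V that unfolding matching_def ends_def by blast
  have "(\<exists>\<alpha> \<beta> k. V_path K V \<alpha> \<beta> k \<and> k \<noteq> 0 \<and> \<alpha> k = \<alpha> 0) \<longleftrightarrow> \<not> acyclic (flow V)"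
  proof
    assume "\<exists>\<alpha> \<beta> k. V_path K V \<alpha> \<beta> k \<and> k \<noteq> 0 \<and> \<alpha> k = \<alpha> 0"
    then obtain \<alpha> \<beta> k where path: "V_path K V \<alpha> \<beta> k" and k: "k \<noteq> 0" "\<alpha> k = \<alpha> 0" by blast
    have vp: "(\<alpha> i, \<beta> i) \<in> V" "facet (\<alpha> (Suc i)) (\<beta> i)" "\<alpha> (Suc i) \<noteq> \<alpha> i" if "i < k" for i
      using path Suc_leI[OF that] that unfolding V_path_def facet_def by auto
    \<comment> \<open>The value \<open>\<beta> k\<close> is arbitrary, so \<open>\<alpha> k\<close>
      has no partner in the path; since \<open>\<alpha> k = \<alpha> 0\<close>, the pair at index 0
      closes the cycle.\<close>
    define g where "g i = (if i = k then (\<alpha> 0, \<beta> 0) else (\<alpha> i, \<beta> i))" for i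
    have "(g i, g (Suc i)) \<in> flow V" if i: "i < k" for i
    proof -
      have "0 < k" using i by simp
      have "g i = (\<alpha> i, \<beta> i)" using i unfolding g_def by simp
      moreover have "fst (g (Suc i)) = \<alpha> (Suc i)" using k(2) unfolding g_def by simp
      moreover have "g (Suc i) \<in> V"
        using vp(1)[OF \<open>0 < k\<close>] vp(1)[of "Suc i"] i unfolding g_def by simp
      ultimately have "g i \<in> V" "g i \<noteq> g (Suc i)" "facet (fst (g (Suc i))) (snd (g i))"
        using vp[OF i] by (simp, metis fst_conv, simp)
      then show ?thesis using \<open>g (Suc i) \<in> V\<close> unfolding flow_def by simp
    qed
    then have "(g 0, g k) \<in> flow V ^^ k" unfolding relpow_fun_conv by blast
    moreover have "g 0 = g k" unfolding g_def by simp
    ultimately have "(g 0, g 0) \<in> (flow V)\<^sup>+" using k(1) unfolding trancl_power by auto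
    then show "\<not> acyclic (flow V)" unfolding acyclic_def by blast
  next
    assume "\<not> acyclic (flow V)"
    then obtain e where "(e, e) \<in> (flow V)\<^sup>+" unfolding acyclic_def by blast
    then obtain k where k: "k > 0" "(e, e) \<in> flow V ^^ k" unfolding trancl_power by blast
    then obtain g where g: "g 0 = e" "g k = e" "\<forall>i<k. (g i, g (Suc i)) \<in> flow V"
      unfolding relpow_fun_conv by blast
    have in_V: "g i \<in> V" if "i \<le> k" for i
      using that g k(1) unfolding flow_def by (cases i) (auto simp: Suc_le_eq)
    have fac: "facet (fst (g i)) (snd (g i))" if "i \<le> k" for i
      using in_V[OF that] sub pairs_facet by blast
    have step: "facet (fst (g (Suc i))) (snd (g i))" "g i \<noteq> g (Suc i)" if "i < k" for i
      using that g unfolding flow_def by blast+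
    \<comment> \<open>The next first component is a facet of \<open>snd (g i)\<close>, which lies
      one dimension above \<open>fst (g i)\<close>.\<close>
    have dim: "sdim (fst (g i)) = sdim (fst (g 0))" if "i \<le> k" for i
      using that
    proof (induction i)
      case (Suc i)
      then show ?case using step(1)[of i] fac[of i] unfolding facet_def by simp
    qed simp
    have "V_path K V (\<lambda>i. fst (g i)) (\<lambda>i. snd (g i)) k"
      unfolding V_path_def
    proof (intro conjI exI[of _ "sdim (fst (g 0))"] allI impI)
      fix i assume i: "i \<le> k"
      show "fst (g i) \<in> K" "sdim (fst (g i)) = sdim (fst (g 0))"
        using fac[OF i] dim[OF i] unfolding facet_def by auto
    next
      fix i assume i: "i < k"
      then have "i \<le> k" "Suc i \<le> k" by auto
      show "snd (g i) \<in> K" "sdim (snd (g i)) = sdim (fst (g 0)) + 1"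
        using fac[OF \<open>i \<le> k\<close>] dim[OF \<open>i \<le> k\<close>] unfolding facet_def by auto
      show "(fst (g i), snd (g i)) \<in> V" using in_V[OF \<open>i \<le> k\<close>] by simp
      show "fst (g (i + 1)) \<subset> snd (g i)" using step(1)[OF i] unfolding facet_def by simp
      show "fst (g (i + 1)) \<noteq> fst (g i)"
        using step(2)[OF i] same_fst[OF in_V[OF \<open>Suc i \<le> k\<close>] in_V[OF \<open>i \<le> k\<close>]] by auto
    qed
    then show "\<exists>\<alpha> \<beta> k. V_path K V \<alpha> \<beta> k \<and> k \<noteq> 0 \<and> \<alpha> k = \<alpha> 0"
      using k(1) g(1,2) by (metis less_irrefl)
  qed
  then show ?thesis unfolding gradient_vector_field_def discrete_vector_field_iff by blast
qed (simp add: gradient_vector_field_def discrete_vector_field_iff)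

lemma morse_iff: "V \<in> morse_complex K \<longleftrightarrow> matching V \<and> acyclic (flow V) \<and> finite V \<and> V \<noteq> {}"
  unfolding morse_complex_def gradient_iff by blast

text \<open>
  Two pairs cannot form a closed path, as two distinct simplices have at most one common facet.
\<close>

lemma pair_in_morse_iff:
  assumes "e \<in> pairs" "e' \<in> pairs"
  shows "{e, e'} \<in> morse_complex K \<longleftrightarrow> e = e' \<or> ends e \<inter> ends e' = {}"
proof
  assume "{e, e'} \<in> morse_complex K"
  then show "e = e' \<or> ends e \<inter> ends e' = {}" unfolding morse_iff matching_def by blast
next
  assume *: "e = e' \<or> ends e \<inter> ends e' = {}"
  have m: "matching {e, e'}" using * assms unfolding matching_def by blast
  have no_cycle: False
    if P: "P \<in> pairs" "Q \<in> pairs" and "ends P \<inter> ends Q = {}" "facet (fst Q) (snd P)" "facet (fst P) (snd Q)"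
    for P Q
  proof -
    have ne: "fst P \<noteq> fst Q" "snd P \<noteq> snd Q" using that(3) unfolding ends_def by auto
    have f: "facet (fst P) (snd P)" "facet (fst Q) (snd Q)" using P pairs_facet by auto
    have "fst P \<union> fst Q = snd P" "fst Q \<union> fst P = snd Q"
      using Union_facets f that(4,5) ne(1) by metis+
    then show False using ne by auto
  qed
  have "acyclic (flow {e, e'})"
  proof (cases "e = e'")
    case True
    then have "flow {e, e'} = {}" unfolding flow_def by auto
    then show ?thesis by (simp add: acyclic_def)
  next
    case False
    then have dj: "ends e \<inter> ends e' = {}" "ends e' \<inter> ends e = {}" using * by auto
    have "flow {e, e'} \<subseteq> {(e, e')} \<or> flow {e, e'} \<subseteq> {(e', e)}"
      using no_cycle[OF assms dj(1)] unfolding flow_def by blast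
    moreover have "acyclic {(P, Q)}" if "P \<noteq> Q" for P Q :: "'a set \<times> 'a set"
      using that acyclic_subset[of "{(P, Q)}" "{}"] by (simp add: acyclic_insert) (simp add: acyclic_def)
    ultimately show ?thesis using False acyclic_subset by metis
  qed
  with m show "{e, e'} \<in> morse_complex K" unfolding morse_iff by simp
qed

end

section \<open>The action of Hasse automorphisms on regular pairs\<close>

context hasse_automorphism
begin

text \<open>The components are exchanged when \<open>f\<close> reverses the edge, so that the image
  is again a regular pair.\<close>

definition act :: "'a set \<times> 'a set \<Rightarrow> 'a set \<times> 'a set" where
  "act e = (if up (fst e) (snd e) then (f (fst e), f (snd e)) else (f (snd e), f (fst e)))"

lemma act_in: "e \<in> pairs \<Longrightarrow> act e \<in> pairs"
  using pairs_facet[of e] not_up[of "fst e" "snd e"] unfolding act_def adj_def by auto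

lemma ends_act: "ends (act e) = f ` ends e"
  unfolding act_def ends_def by auto

lemma act_eqI: "e \<in> pairs \<Longrightarrow> e' \<in> pairs \<Longrightarrow> ends e' = f ` ends e \<Longrightarrow> act e = e'"
  using inj_ends_pairs act_in ends_act by (metis inj_onD)

lemma ends_subset: "e \<in> pairs \<Longrightarrow> ends e \<subseteq> K"
  using pairs_facet unfolding ends_def facet_def by blast

lemma image_ends_Int:
  "e \<in> pairs \<Longrightarrow> e' \<in> pairs \<Longrightarrow> f ` ends e \<inter> f ` ends e' = f ` (ends e \<inter> ends e')"
  using bij ends_subset by (metis bij_betw_def inj_on_image_Int)

lemma inj_act: "inj_on act pairs"
proof (rule inj_onI)
  fix e e' assume e: "e \<in> pairs" "e' \<in> pairs" "act e = act e'"
  then have "f ` ends e = f ` ends e'" using ends_act by metis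
  then have "ends e = ends e'" using e bij ends_subset by (meson bij_betw_def inj_on_image_eq_iff)
  then show "e = e'" using e inj_ends_pairs by (meson inj_onD)
qed

lemma act_surj: "act ` pairs = pairs"
proof
  show "pairs \<subseteq> act ` pairs"
  proof
    fix e assume e: "e \<in> pairs"
    then have "fst e \<in> K" "snd e \<in> K" using ends_subset unfolding ends_def by auto
    then obtain \<sigma> \<tau> where st: "\<sigma> \<in> K" "f \<sigma> = fst e" "\<tau> \<in> K" "f \<tau> = snd e" using surj_obtain by metis
    have "adj (f \<sigma>) (f \<tau>)" using st pairs_facet[OF e] unfolding adj_def by simp
    then have "adj \<sigma> \<tau>" using st adj_image by blast
    then obtain e' where "e' \<in> pairs" "ends e' = {\<sigma>, \<tau>}" unfolding ends_adj[symmetric] by auto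
    moreover then have "act e' = e" using e st by (intro act_eqI) (auto simp: ends_def[of e])
    ultimately show "e \<in> act ` pairs" by blast
  qed
qed (use act_in in blast)

lemma act_star:
  assumes "v \<in> K"
  shows "act ` star pairs v = star pairs (f v)"
proof -
  have *: "v \<in> ends e \<longleftrightarrow> f v \<in> ends (act e)" if "e \<in> pairs" for e
    using bij ends_subset[OF that] assms unfolding ends_act
    by (metis bij_betw_def inj_on_image_mem_iff)
  show ?thesis
  proof
    show "act ` star pairs v \<subseteq> star pairs (f v)" unfolding star_def using * act_in by auto
    show "star pairs (f v) \<subseteq> act ` star pairs v"
    proof
      fix e assume e: "e \<in> star pairs (f v)"
      then have "e \<in> act ` pairs" unfolding act_surj star_def by simp
      then show "e \<in> act ` star pairs v" using e * unfolding star_def by auto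
    qed
  qed
qed

lemma matching_act:
  assumes "matching V"
  shows "matching (act ` V)"
proof -
  have V: "V \<subseteq> pairs" using assms unfolding matching_def by blast
  have "ends (act e) \<inter> ends (act e') = {}" if e: "e \<in> V" "e' \<in> V" "act e \<noteq> act e'" for e e'
  proof -
    have "e \<noteq> e'" using e(3) by auto
    then have "ends e \<inter> ends e' = {}" using assms e(1,2) unfolding matching_def by blast
    moreover have "e \<in> pairs" "e' \<in> pairs" using V e by auto
    ultimately show ?thesis by (simp add: ends_act image_ends_Int)
  qed
  moreover have "act ` V \<subseteq> pairs" using V act_in by blast
  ultimately show ?thesis unfolding matching_def by (simp add: ball_simps(9))
qed

text \<open>
  A reversing automorphism exchanges the two components of each pair and thereby reverses
  closed paths.
\<close>

lemma flow_act:
  assumes "V \<subseteq> pairs"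
  shows "(\<forall>e\<in>V. \<forall>e'\<in>V. (act e, act e') \<in> flow (act ` V) \<longrightarrow> (e, e') \<in> flow V) \<or>
    (\<forall>e\<in>V. \<forall>e'\<in>V. (act e, act e') \<in> flow (act ` V) \<longrightarrow> (e, e') \<in> (flow V)\<inverse>)"
  using preserves_or_reverses
proof
  assume up: "\<forall>\<sigma> \<tau>. facet \<sigma> \<tau> \<longrightarrow> facet (f \<sigma>) (f \<tau>)"
  have "(e, e') \<in> flow V" if e: "e \<in> V" "e' \<in> V" and fl: "(act e, act e') \<in> flow (act ` V)" for e e'
  proof -
    have fac: "facet (fst e) (snd e)" "facet (fst e') (snd e')"
      using e assms pairs_facet by blast+
    then have "up (fst e') (snd e)" "e \<noteq> e'" using fl up unfolding flow_def act_def by auto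
    moreover have "fst e' \<in> K" "snd e \<in> K" using fac unfolding facet_def by auto
    ultimately have "facet (fst e') (snd e)" using up adj_image facet_asym unfolding adj_def by metis
    then show ?thesis using e \<open>e \<noteq> e'\<close> unfolding flow_def by blast
  qed
  then show ?thesis by blast
next
  assume dn: "\<forall>\<sigma> \<tau>. facet \<sigma> \<tau> \<longrightarrow> facet (f \<tau>) (f \<sigma>)"
  have "(e', e) \<in> flow V" if e: "e \<in> V" "e' \<in> V" and fl: "(act e, act e') \<in> flow (act ` V)" for e e'
  proof -
    have fac: "facet (fst e) (snd e)" "facet (fst e') (snd e')"
      using e assms pairs_facet by blast+
    then have "\<not> up (fst e) (snd e)" "\<not> up (fst e') (snd e')" using dn facet_asym by blast+
    then have "up (snd e') (fst e)" "e \<noteq> e'" using fl unfolding flow_def act_def by auto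
    moreover have "fst e \<in> K" "snd e' \<in> K" using fac unfolding facet_def by auto
    ultimately have "facet (fst e) (snd e')" using dn adj_image facet_asym unfolding adj_def by metis
    then show ?thesis using e \<open>e \<noteq> e'\<close> unfolding flow_def by blast
  qed
  then show ?thesis by blast
qed

text \<open>A cycle in the flow of the image pulls back along \<open>g\<close> to a cycle of
  \<open>flow V\<close> or of its converse, and a relation and its converse are acyclic
  together.\<close>

lemma act_morse:
  assumes "V \<in> morse_complex K"
  shows "act ` V \<in> morse_complex K"
proof -
  have V: "matching V" "acyclic (flow V)" "finite V" "V \<noteq> {}" using assms unfolding morse_iff by auto
  then have sub: "V \<subseteq> pairs" unfolding matching_def by blast
  define g where "g = inv_into V act"
  have g: "g e \<in> V" "act (g e) = e" if "e \<in> act ` V" for e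
    using that unfolding g_def by (auto intro: inv_into_into f_inv_into_f)
  have "flow (act ` V) \<subseteq> inv_image (flow V) g \<or> flow (act ` V) \<subseteq> inv_image ((flow V)\<inverse>) g"
  proof -
    have *: "g e \<in> V \<and> g e' \<in> V \<and> (act (g e), act (g e')) \<in> flow (act ` V)"
      if "(e, e') \<in> flow (act ` V)" for e e'
    proof -
      have "e \<in> act ` V" "e' \<in> act ` V" using that unfolding flow_def by auto
      then show ?thesis using g that by simp
    qed
    show ?thesis using flow_act[OF sub] * unfolding inv_image_def by blast
  qed
  moreover have "acyclic (inv_image (flow V) g)" "acyclic (inv_image ((flow V)\<inverse>) g)"
    using V(2) by (auto intro!: acyclic_inv_imageI)
  ultimately have "acyclic (flow (act ` V))" using acyclic_subset by metis
  then show ?thesis using V matching_act unfolding morse_iff by simp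
qed

end

section \<open>The isomorphism of the automorphism groups\<close>

context connected_simplicial_complex
begin

lemma hasse_automorphismI:
  assumes "f \<in> graph_auts K (hasse_edges K)"
  shows "hasse_automorphism K f"
proof
  show "bij_betw f K K" using assms unfolding graph_auts_def Bij_def by auto
  show "adj (f \<sigma>) (f \<tau>) \<longleftrightarrow> adj \<sigma> \<tau>" if "\<sigma> \<in> K" "\<tau> \<in> K" for \<sigma> \<tau>
    using assms that unfolding graph_auts_def hasse_edges_iff by blast
qed

definition morse_act :: "('a set \<Rightarrow> 'a set) \<Rightarrow> ('a set \<times> 'a set) set \<Rightarrow> ('a set \<times> 'a set) set" where
  "morse_act f = (\<lambda>V\<in>morse_complex K. hasse_automorphism.act K f ` V)"

lemma morse_subset_pairs: "V \<in> morse_complex K \<Longrightarrow> V \<subseteq> pairs"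
  unfolding morse_iff matching_def by blast

lemma singleton_in_morse: "e \<in> pairs \<Longrightarrow> {e} \<in> morse_complex K"
  using pair_in_morse_iff[of e e] by simp

lemma morse_act_aut:
  assumes "finite K" "f \<in> graph_auts K (hasse_edges K)"
  shows "morse_act f \<in> simplicial_auts (morse_complex K)"
proof -
  interpret f: hasse_automorphism K f by (rule hasse_automorphismI[OF assms(2)])
  have "finite (morse_complex K)"
    by (rule finite_subset[of _ "Pow pairs"]) (use morse_subset_pairs finite_pairs[OF assms(1)] in auto)
  moreover have "inj_on (morse_act f) (morse_complex K)"
    by (rule inj_onI)
      (simp add: morse_act_def inj_on_image_eq_iff[OF f.inj_act morse_subset_pairs morse_subset_pairs])
  moreover have "morse_act f \<in> morse_complex K \<rightarrow> morse_complex K"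
    unfolding morse_act_def using f.act_morse by simp
  ultimately have "bij_betw (morse_act f) (morse_complex K) (morse_complex K)"
    unfolding bij_betw_def using endo_inj_surj by (metis image_subset_iff_funcset)
  then have "morse_act f \<in> Bij (morse_complex K)" unfolding Bij_def morse_act_def by simp
  moreover have "f.act \<in> pairs \<rightarrow> pairs" using f.act_in by blast
  ultimately show ?thesis
    unfolding simplicial_auts_def Union_morse using f.act_morse
    by (auto simp: morse_act_def intro!: bexI[of _ f.act])
qed

lemma morse_act_compose:
  assumes "f \<in> graph_auts K (hasse_edges K)" "g \<in> graph_auts K (hasse_edges K)"
  shows "morse_act (compose K f g) = compose (morse_complex K) (morse_act f) (morse_act g)"
proof -
  interpret f: hasse_automorphism K f by (rule hasse_automorphismI[OF assms(1)])
  interpret g: hasse_automorphism K g by (rule hasse_automorphismI[OF assms(2)])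
  have "compose K f g \<in> graph_auts K (hasse_edges K)"
    using subgroup.m_closed[OF subgroup_graph_auts assms] assms
    by (simp add: BijGroup_def graph_auts_def)
  then interpret fg: hasse_automorphism K "compose K f g" by (rule hasse_automorphismI)
  \<comment> \<open>Both sides are regular pairs with the same ends, and these determine a regular
    pair whatever the directions.\<close>
  have "fg.act e = f.act (g.act e)" if e: "e \<in> pairs" for e
  proof (rule fg.act_eqI)
    have "f ` g ` ends e = compose K f g ` ends e"
      using g.ends_subset[OF e] by (auto simp: compose_def image_iff)
    then show "ends (f.act (g.act e)) = compose K f g ` ends e"
      by (simp add: f.ends_act g.ends_act)
  qed (use e f.act_in g.act_in in auto)
  then have "fg.act ` V = f.act ` g.act ` V" if "V \<in> morse_complex K" for V
    using morse_subset_pairs[OF that] by (force simp: image_image)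
  then show ?thesis
    unfolding morse_act_def compose_def using g.act_morse by (auto simp: fun_eq_iff restrict_def)
qed

text \<open>Singleton simplices reveal the action on edges. This gives the image of each star and
  hence, by \<open>inj_star\<close>, the image of each node.\<close>

lemma inj_morse_act:
  assumes "finite K"
  shows "inj_on morse_act (graph_auts K (hasse_edges K))"
proof (rule inj_onI)
  fix f g assume fg: "f \<in> graph_auts K (hasse_edges K)" "g \<in> graph_auts K (hasse_edges K)"
    and eq: "morse_act f = morse_act g"
  interpret H: triangle_free_graph K pairs by (rule triangle_free_hasse[OF assms])
  interpret f: hasse_automorphism K f by (rule hasse_automorphismI[OF fg(1)])
  interpret g: hasse_automorphism K g by (rule hasse_automorphismI[OF fg(2)])
  have act: "f.act e = g.act e" if "e \<in> pairs" for e
    using fun_cong[OF eq, of "{e}"] singleton_in_morse[OF that] unfolding morse_act_def by simp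
  have "f v = g v" if v: "v \<in> K" for v
  proof -
    have "f.act ` star pairs v = g.act ` star pairs v"
      using act unfolding star_def by (intro image_cong) auto
    then have "star pairs (f v) = star pairs (g v)"
      using f.act_star[OF v] g.act_star[OF v] by simp
    then show ?thesis using H.inj_star f.image_in g.image_in v by (meson inj_onD)
  qed
  moreover have "f \<in> extensional K" "g \<in> extensional K"
    using fg unfolding graph_auts_def Bij_def by auto
  ultimately show "f = g" by (auto intro: extensionalityI)
qed

text \<open>The vertex map \<open>p\<close> of \<open>\<phi>\<close> permutes the regular pairs, and
  the edges of the Morse complex record which pairs are disjoint. So \<open>p\<close> is an edge
  permutation that respects incidence, hence is induced by a node map; since ends determine a
  regular pair, that map acts as \<open>p\<close>.\<close>

lemma morse_act_surj:
  assumes "finite K" "\<phi> \<in> simplicial_auts (morse_complex K)"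
  obtains f where "f \<in> graph_auts K (hasse_edges K)" "morse_act f = \<phi>"
proof -
  let ?M = "morse_complex K"
  obtain p where \<phi>: "\<phi> \<in> Bij ?M" and p: "p \<in> pairs \<rightarrow> pairs" "\<And>V. V \<in> ?M \<Longrightarrow> \<phi> V = p ` V"
    using assms(2) unfolding simplicial_auts_def Union_morse mem_Collect_eq by metis
  have bij: "bij_betw \<phi> ?M ?M" using \<phi> unfolding Bij_def by simp
  have inj_p: "inj_on p pairs"
  proof (rule inj_onI)
    fix e e' assume e: "e \<in> pairs" "e' \<in> pairs" "p e = p e'"
    then have "\<phi> {e} = \<phi> {e'}" using p(2) singleton_in_morse by simp
    then show "e = e'" using bij singleton_in_morse e by (metis bij_betw_def inj_onD singleton_inject)
  qed
  then have bij_p: "bij_betw p pairs pairs"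
    using endo_inj_surj[OF finite_pairs[OF assms(1)], of p] p(1)
    by (simp add: bij_betw_def image_subset_iff_funcset)
  have edge: "{p e, p e'} \<in> ?M \<longleftrightarrow> {e, e'} \<in> ?M" if e: "e \<in> pairs" "e' \<in> pairs" for e e'
  proof
    assume "{e, e'} \<in> ?M"
    then show "{p e, p e'} \<in> ?M" using p(2)[of "{e, e'}"] bij by (metis bij_betw_apply image_empty image_insert)
  next
    assume "{p e, p e'} \<in> ?M"
    \<comment> \<open>Surjectivity of \<open>\<phi>\<close> provides a simplex over
      \<open>{p e, p e'}\<close>, and injectivity of \<open>p\<close> forces it to be
      \<open>{e, e'}\<close>.\<close>
    then obtain V where V: "V \<in> ?M" "\<phi> V = {p e, p e'}" using bij by (metis bij_betw_def imageE)
    then have "p ` V = p ` {e, e'}" using p(2) by simp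
    then have "V = {e, e'}"
      using inj_on_image_eq_iff[OF inj_p morse_subset_pairs[OF V(1)], of "{e, e'}"] e by simp
    then show "{e, e'} \<in> ?M" using V by simp
  qed
  interpret H: triangle_free_graph K pairs by (rule triangle_free_hasse[OF assms(1)])
  have meet: "ends (p e) \<inter> ends (p e') \<noteq> {} \<longleftrightarrow> ends e \<inter> ends e' \<noteq> {}"
    if e: "e \<in> pairs" "e' \<in> pairs" for e e'
  proof (cases "e = e'")
    case True
    then show ?thesis by (simp add: ends_def)
  next
    case False
    then have "p e \<noteq> p e'" using inj_p e by (meson inj_onD)
    moreover have "p e \<in> pairs" "p e' \<in> pairs" using p(1) e by auto
    ultimately show ?thesis using edge[OF e] pair_in_morse_iff e False by simp
  qed
  obtain f0 where f0: "bij_betw f0 K K" "\<And>e. e \<in> pairs \<Longrightarrow> ends (p e) = f0 ` ends e"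
    using H.edge_automorphism_induced[OF bij_p meet] by blast
  define f where "f = restrict f0 K"
  have f: "bij_betw f K K" using f0(1) unfolding f_def by simp
  have ends_p: "ends (p e) = f ` ends e" if "e \<in> pairs" for e
    using f0(2)[OF that] H.ends_nodes[OF that] unfolding f_def by force
  have "{f x, f y} \<in> ends ` pairs \<longleftrightarrow> {x, y} \<in> ends ` pairs" if xy: "x \<in> K" "y \<in> K" for x y
  proof
    assume "{x, y} \<in> ends ` pairs"
    then obtain e where "e \<in> pairs" "ends e = {x, y}" by auto
    then have "ends (p e) = {f x, f y}" "p e \<in> pairs" using ends_p p(1) by auto
    then show "{f x, f y} \<in> ends ` pairs" by (metis imageI)
  next
    assume "{f x, f y} \<in> ends ` pairs"
    then obtain e where e: "e \<in> pairs" "ends (p e) = {f x, f y}"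
      using bij_p by (metis bij_betw_def imageE)
    then have "f ` ends e = f ` {x, y}" using ends_p by simp
    then have "ends e = {x, y}"
      using f xy H.ends_nodes[OF e(1)] by (metis bij_betw_def empty_subsetI inj_on_image_eq_iff insert_subset)
    then show "{x, y} \<in> ends ` pairs" using e by (metis imageI)
  qed
  then have aut: "f \<in> graph_auts K (hasse_edges K)"
    using f unfolding graph_auts_def hasse_edges_iff ends_adj Bij_def f_def by simp
  then interpret f: hasse_automorphism K f by (rule hasse_automorphismI)
  have "f.act e = p e" if "e \<in> pairs" for e
    using that p(1) ends_p by (intro f.act_eqI) auto
  then have "f.act ` V = p ` V" if "V \<in> ?M" for V
    using morse_subset_pairs[OF that] by (intro image_cong) auto
  then have "morse_act f V = \<phi> V" if "V \<in> ?M" for V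
    using that p(2) unfolding morse_act_def by simp
  moreover have "morse_act f \<in> extensional ?M" "\<phi> \<in> extensional ?M"
    using \<phi> unfolding morse_act_def Bij_def by auto
  ultimately have "morse_act f = \<phi>" by (auto intro: extensionalityI)
  then show thesis using that aut by blast
qed

lemma morse_act_iso:
  assumes "finite K"
  shows "morse_act \<in> iso (graph_aut_group K (hasse_edges K)) (simplicial_aut_group (morse_complex K))"
proof (rule isoI)
  show "morse_act \<in> hom (graph_aut_group K (hasse_edges K)) (simplicial_aut_group (morse_complex K))"
  proof (rule homI)
    fix f g
    assume "f \<in> carrier (graph_aut_group K (hasse_edges K))" "g \<in> carrier (graph_aut_group K (hasse_edges K))"
    then have fg: "f \<in> graph_auts K (hasse_edges K)" "g \<in> graph_auts K (hasse_edges K)"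
      unfolding graph_aut_group_def by auto
    then have "f \<in> Bij K" "g \<in> Bij K" unfolding graph_auts_def by auto
    moreover have "morse_act f \<in> Bij (morse_complex K)" "morse_act g \<in> Bij (morse_complex K)"
      using morse_act_aut[OF assms] fg unfolding simplicial_auts_def by auto
    ultimately show "morse_act (f \<otimes>\<^bsub>graph_aut_group K (hasse_edges K)\<^esub> g) =
        morse_act f \<otimes>\<^bsub>simplicial_aut_group (morse_complex K)\<^esub> morse_act g"
      using morse_act_compose[OF fg] unfolding graph_aut_group_def simplicial_aut_group_def BijGroup_def
      by simp
  qed (use morse_act_aut[OF assms] in \<open>simp add: graph_aut_group_def simplicial_aut_group_def\<close>)
  show "bij_betw morse_act (carrier (graph_aut_group K (hasse_edges K)))
      (carrier (simplicial_aut_group (morse_complex K)))"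
    unfolding bij_betw_def graph_aut_group_def simplicial_aut_group_def
    using inj_morse_act[OF assms] morse_act_aut[OF assms] morse_act_surj[OF assms] by auto blast
qed

end

theorem proposition22:
  fixes K :: "'a set set"
  assumes "abstract_complex K"
    and "finite K"
    and "connected_complex K"
  shows "simplicial_aut_group (morse_complex K) \<cong> graph_aut_group K (hasse_edges K)"
proof -
  interpret connected_simplicial_complex K using assms by unfold_locales
  have "graph_aut_group K (hasse_edges K) \<cong> simplicial_aut_group (morse_complex K)"
    using morse_act_iso[OF assms(2)] unfolding is_iso_def by blast
  then show ?thesis by (rule group.iso_sym[OF group_graph_aut_group])
qed

end
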